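(* Let $\mathfrak{A}$ be a complete atomic weakly associative relation algebra, let $\mathfrak{B}=\langle B,T_\kappa,E_{\kappa\lambda}\rangle_{\kappa,\lambda<3}$ be its suitable structure, for every $t\in B$ let $R_t=\{\langle(p0)^{\mathfrak{B}},(p1)^{\mathfrak{B}},(p2)^{\mathfrak{B}}\rangle:p\in\mathrm{Tr}(\mathfrak{B}),\ p\text{ ends at }t\}$, and let $\mathfrak{C}$ be the subalgebra of the full 3-dimensional cylindric set algebra on $U(\mathfrak{B})$ completely generated by $\{R_t:t\in B\}$. Then $\mathfrak{A}\cong\mathfrak{Ra}\,\mathfrak{Rl}_{V(\mathfrak{B})}(\mathfrak{C})$, and $\{R_t:t\in B\}$ is the set of atoms of $\mathfrak{Rl}_{V(\mathfrak{B})}(\mathfrak{C})$.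
   Context: WA: algebras $\langle A,+,\overline{\phantom{x}},;,\breve{\phantom{x}},1'\rangle$ with $x\cdot y=\overline{\overline{x}+\overline{y}}$, $0'=\overline{1'}$, $1=1'+0'$, $0=\overline{1}$, satisfying for all $x,y,z$: $x+y=y+x$; $x+(y+z)=(x+y)+z$; $\overline{\overline{x}+\overline{y}}+\overline{\overline{x}+y}=x$; $((x\cdot 1');1);1=(x\cdot1');1$; $(x+y);z=x;z+y;z$; $x;1'=x$; $\breve{\breve{x}}=x$; $\breve{(x+y)}=\breve{x}+\breve{y}$; $\breve{(x;y)}=\breve{y};\breve{x}$; $\breve{x};\overline{x;y}+\overline{y}=\overline{y}$. $\mathrm{At}(\mathfrak{A})$ = atoms. Suitable structure: $B=\{s\in{}^3\mathrm{At}(\mathfrak{A}): s_2;s_0\ge s_1\}$; $T_\kappa=\{\langle s,t\rangle\in B\times B:s_\kappa=t_\kappa\}$; $E_{\kappa\kappa}=B$; for distinct $\kappa,\lambda$ with third index $\mu$, $E_{\kappa\lambda}=\{s\in B:s_\mu\le1'\}$. Trails: a $\mathfrak{B}$-trail is $p=\langle t_0,\kappa_0,\dots,t_n,\kappa_n\rangle$, $n\in\omega$, $t_i\in B$, $\kappa_i<3$, with $t_i\ne t_{i+1}$ and $\langle t_i,t_{i+1}\rangle\in T_{\kappa_i}$ for $i<n$; it ends at $t_n$. $\mathrm{Tr}(\mathfrak{B})$ = set of trails; $p\lambda=\langle t_0,\kappa_0,\dots,t_n,\lambda\rangle$. $\approx$ is the smallest equivalence relation on $\mathrm{Tr}(\mathfrak{B})$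 with (for trails of the displayed forms): (a) $\langle t_0,\kappa_0,\dots,t_i,\lambda,s,\lambda,t_i,\kappa_i,\dots,t_n,\kappa_n\rangle\approx\langle t_0,\kappa_0,\dots,t_i,\kappa_i,\dots,t_n,\kappa_n\rangle$; (b) $\langle t_0,\kappa_0,\dots,t_n,\lambda,s,\nu\rangle\approx\langle t_0,\kappa_0,\dots,t_n,\nu\rangle$ if $\lambda\ne\nu$; (c) $\langle t_0,\kappa_0,\dots,t_n,\lambda\rangle\approx\langle t_0,\kappa_0,\dots,t_n,\kappa_n\rangle$ if $t_n\in E_{\lambda\kappa_n}$. $p^{\mathfrak{B}}$ = $\approx$-class; $U(\mathfrak{B})=\{p^{\mathfrak{B}}:p\in\mathrm{Tr}(\mathfrak{B})\}$; $V(\mathfrak{B})=\bigcup_{t\in B}R_t$. The full cylindric set algebra on $U$: $\langle\mathcal{P}({}^3U),\cup,{}^3U\setminus\cdot,C_\kappa,D_{\kappa\lambda}\rangle_{\kappa,\lambda<3}$, $C_\kappa X=\{v\in{}^3U:\exists u\in X\ \forall\lambda\ne\kappa\ u_\lambda=v_\lambda\}$, $D_{\kappa\lambda}=\{v:v_\kappa=v_\lambda\}$; "completely generated" means the smallest subalgebra closed also under arbitrary unions. $\mathfrak{Rl}_V(\mathfrak{C})$: universe $\{X\in C:X\subseteq V\}$, operations $\cup$, $V\setminus\cdot$, $C^{[V]}_\kappa X=V\cap C_\kappa X$, constants $D^{[V]}_{\kappa\lambda}=V\cap D_{\kappa\lambda}$. Relation-algebraic reduct: for $\mathfrak{D}=\langle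 D,+,\overline{\phantom{x}},c_\kappa,d_{\kappa\lambda}\rangle_{\kappa,\lambda<3}$, $Nr_2\mathfrak{D}=\{x:c_2x=x\}$, $x;y=c_2(c_1(d_{12}\cdot x)\cdot c_0(d_{02}\cdot y))$, $\breve{x}=c_2(d_{20}\cdot c_0(d_{01}\cdot c_1(d_{12}\cdot x)))$, $\mathfrak{Ra}\,\mathfrak{D}=\langle Nr_2\mathfrak{D},+,\overline{\phantom{x}},;,\breve{\phantom{x}},d_{01}\rangle$. *)

theory Defs
  imports Main
begin

record 'a wa_alg =
  wcar :: "'a set"
  wplus :: "'a \<Rightarrow> 'a \<Rightarrow> 'a"
  wcompl :: "'a \<Rightarrow> 'a"
  wcomp :: "'a \<Rightarrow> 'a \<Rightarrow> 'a"
  wconv :: "'a \<Rightarrow> 'a"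
  wid :: 'a

definition wmeet :: "('a, 'm) wa_alg_scheme \<Rightarrow> 'a \<Rightarrow> 'a \<Rightarrow> 'a" where
  "wmeet A x y = wcompl A (wplus A (wcompl A x) (wcompl A y))"

definition wdiv :: "('a, 'm) wa_alg_scheme \<Rightarrow> 'a" where
  "wdiv A = wcompl A (wid A)"

definition wone :: "('a, 'm) wa_alg_scheme \<Rightarrow> 'a" where
  "wone A = wplus A (wid A) (wdiv A)"

definition wzero :: "('a, 'm) wa_alg_scheme \<Rightarrow> 'a" where
  "wzero A = wcompl A (wone A)"

definition wle :: "('a, 'm) wa_alg_scheme \<Rightarrow> 'a \<Rightarrow> 'a \<Rightarrow> bool" where
  "wle A x y \<longleftrightarrow> wplus A x y = y"

definition is_wa :: "('a, 'm) wa_alg_scheme \<Rightarrow> bool" where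
  "is_wa A \<longleftrightarrow>
     wid A \<in> wcar A \<and>
     (\<forall>x\<in>wcar A. \<forall>y\<in>wcar A. wplus A x y \<in> wcar A \<and> wcomp A x y \<in> wcar A) \<and>
     (\<forall>x\<in>wcar A. wcompl A x \<in> wcar A \<and> wconv A x \<in> wcar A) \<and>
     (\<forall>x\<in>wcar A. \<forall>y\<in>wcar A. \<forall>z\<in>wcar A.
        wplus A x y = wplus A y x \<and>
        wplus A x (wplus A y z) = wplus A (wplus A x y) z \<and>
        wplus A (wcompl A (wplus A (wcompl A x) (wcompl A y)))
                (wcompl A (wplus A (wcompl A x) y)) = x \<and>
        wcomp A (wcomp A (wmeet A x (wid A)) (wone A)) (wone A)
          = wcomp A (wmeet A x (wid A)) (wone A) \<and>
        wcomp A (wplus A x y) z = wplus A (wcomp A x z) (wcomp A y z) \<and>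
        wcomp A x (wid A) = x \<and>
        wconv A (wconv A x) = x \<and>
        wconv A (wplus A x y) = wplus A (wconv A x) (wconv A y) \<and>
        wconv A (wcomp A x y) = wcomp A (wconv A y) (wconv A x) \<and>
        wplus A (wcomp A (wconv A x) (wcompl A (wcomp A x y))) (wcompl A y) = wcompl A y)"

definition wa_atom :: "('a, 'm) wa_alg_scheme \<Rightarrow> 'a \<Rightarrow> bool" where
  "wa_atom A x \<longleftrightarrow> x \<in> wcar A \<and> x \<noteq> wzero A \<and>
     (\<forall>y\<in>wcar A. wle A y x \<longrightarrow> y = wzero A \<or> y = x)"

definition wa_At :: "('a, 'm) wa_alg_scheme \<Rightarrow> 'a set" where
  "wa_At A = {x. wa_atom A x}"

definition wa_complete :: "('a, 'm) wa_alg_scheme \<Rightarrow> bool" where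
  "wa_complete A \<longleftrightarrow> (\<forall>S\<subseteq>wcar A. \<exists>s\<in>wcar A. (\<forall>x\<in>S. wle A x s) \<and>
      (\<forall>u\<in>wcar A. (\<forall>x\<in>S. wle A x u) \<longrightarrow> wle A s u))"

definition wa_atomic :: "('a, 'm) wa_alg_scheme \<Rightarrow> bool" where
  "wa_atomic A \<longleftrightarrow> (\<forall>x\<in>wcar A. x \<noteq> wzero A \<longrightarrow> (\<exists>a. wa_atom A a \<and> wle A a x))"

definition wa_iso :: "('a, 'm) wa_alg_scheme \<Rightarrow> ('b, 'n) wa_alg_scheme \<Rightarrow> bool" where
  "wa_iso A B \<longleftrightarrow> (\<exists>f. bij_betw f (wcar A) (wcar B) \<and>
     f (wid A) = wid B \<and>
     (\<forall>x\<in>wcar A. f (wcompl A x) = wcompl B (f x) \<and> f (wconv A x) = wconv B (f x)) \<and>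
     (\<forall>x\<in>wcar A. \<forall>y\<in>wcar A. f (wplus A x y) = wplus B (f x) (f y) \<and>
                              f (wcomp A x y) = wcomp B (f x) (f y)))"

definition tc :: "'b \<times> 'b \<times> 'b \<Rightarrow> nat \<Rightarrow> 'b" where
  "tc s k = (if k = 0 then fst s else if k = 1 then fst (snd s) else snd (snd s))"

definition suitB :: "('a, 'm) wa_alg_scheme \<Rightarrow> ('a \<times> 'a \<times> 'a) set" where
  "suitB A = {s. (\<forall>k<3. tc s k \<in> wa_At A) \<and> wle A (tc s 1) (wcomp A (tc s 2) (tc s 0))}"

definition suitT :: "('a, 'm) wa_alg_scheme \<Rightarrow> nat \<Rightarrow> (('a \<times> 'a \<times> 'a) \<times> ('a \<times> 'a \<times> 'a)) set" where
  "suitT A k = {(s, t). s \<in> suitB A \<and> t \<in> suitB A \<and> tc s k = tc t k}"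

text \<open>For distinct k, l < 3 the third index is 3 - k - l.\<close>
definition suitE :: "('a, 'm) wa_alg_scheme \<Rightarrow> nat \<Rightarrow> nat \<Rightarrow> ('a \<times> 'a \<times> 'a) set" where
  "suitE A k l = (if k = l then suitB A
                  else {s \<in> suitB A. wle A (tc s (3 - k - l)) (wid A)})"

type_synonym 'a trail = "(('a \<times> 'a \<times> 'a) \<times> nat) list"

definition is_trail :: "('a, 'm) wa_alg_scheme \<Rightarrow> 'a trail \<Rightarrow> bool" where
  "is_trail A p \<longleftrightarrow> p \<noteq> [] \<and>
     (\<forall>i<length p. fst (p ! i) \<in> suitB A \<and> snd (p ! i) < 3) \<and>
     (\<forall>i. Suc i < length p \<longrightarrow> fst (p ! i) \<noteq> fst (p ! Suc i) \<and>
          (fst (p ! i), fst (p ! Suc i)) \<in> suitT A (snd (p ! i)))"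

definition Trl :: "('a, 'm) wa_alg_scheme \<Rightarrow> 'a trail set" where
  "Trl A = {p. is_trail A p}"

definition ends_at :: "'a trail \<Rightarrow> ('a \<times> 'a \<times> 'a) \<Rightarrow> bool" where
  "ends_at p t \<longleftrightarrow> fst (last p) = t"

definition tr_upd :: "'a trail \<Rightarrow> nat \<Rightarrow> 'a trail" where
  "tr_upd p l = butlast p @ [(fst (last p), l)]"

definition trail_step :: "('a, 'm) wa_alg_scheme \<Rightarrow> 'a trail \<Rightarrow> 'a trail \<Rightarrow> bool" where
  "trail_step A p q \<longleftrightarrow> p \<in> Trl A \<and> q \<in> Trl A \<and>
     ((\<exists>pre suf t l s k. p = pre @ [(t, l), (s, l), (t, k)] @ suf \<and> q = pre @ [(t, k)] @ suf) \<or>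
      (\<exists>pre t l s n. l \<noteq> n \<and> p = pre @ [(t, l), (s, n)] \<and> q = pre @ [(t, n)]) \<or>
      (\<exists>pre t l k. t \<in> suitE A l k \<and> p = pre @ [(t, l)] \<and> q = pre @ [(t, k)]))"

inductive trail_eq :: "('a, 'm) wa_alg_scheme \<Rightarrow> 'a trail \<Rightarrow> 'a trail \<Rightarrow> bool"
  for A :: "('a, 'm) wa_alg_scheme" where
  teq_refl: "p \<in> Trl A \<Longrightarrow> trail_eq A p p"
| teq_step: "trail_step A p q \<Longrightarrow> trail_eq A p q"
| teq_sym: "trail_eq A p q \<Longrightarrow> trail_eq A q p"
| teq_trans: "trail_eq A p q \<Longrightarrow> trail_eq A q r \<Longrightarrow> trail_eq A p r"

definition trail_cls :: "('a, 'm) wa_alg_scheme \<Rightarrow> 'a trail \<Rightarrow> 'a trail set" where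
  "trail_cls A p = {q. trail_eq A p q}"

definition UB :: "('a, 'm) wa_alg_scheme \<Rightarrow> 'a trail set set" where
  "UB A = trail_cls A ` Trl A"

definition RB :: "('a, 'm) wa_alg_scheme \<Rightarrow> ('a \<times> 'a \<times> 'a)
     \<Rightarrow> ('a trail set \<times> 'a trail set \<times> 'a trail set) set" where
  "RB A t = {(trail_cls A (tr_upd p 0), trail_cls A (tr_upd p 1), trail_cls A (tr_upd p 2)) | p.
              p \<in> Trl A \<and> ends_at p t}"

definition VB :: "('a, 'm) wa_alg_scheme \<Rightarrow> ('a trail set \<times> 'a trail set \<times> 'a trail set) set" where
  "VB A = (\<Union>t\<in>suitB A. RB A t)"

definition cube :: "'u set \<Rightarrow> ('u \<times> 'u \<times> 'u) set" where
  "cube U = U \<times> U \<times> U"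

definition cyl :: "'u set \<Rightarrow> nat \<Rightarrow> ('u \<times> 'u \<times> 'u) set \<Rightarrow> ('u \<times> 'u \<times> 'u) set" where
  "cyl U k X = {v \<in> cube U. \<exists>u\<in>X. \<forall>l<3. l \<noteq> k \<longrightarrow> tc u l = tc v l}"

definition diag :: "'u set \<Rightarrow> nat \<Rightarrow> nat \<Rightarrow> ('u \<times> 'u \<times> 'u) set" where
  "diag U k l = {v \<in> cube U. tc v k = tc v l}"

inductive_set cgen :: "'u set \<Rightarrow> ('u \<times> 'u \<times> 'u) set set \<Rightarrow> ('u \<times> 'u \<times> 'u) set set"
  for U :: "'u set" and G :: "('u \<times> 'u \<times> 'u) set set" where
  cgen_gen: "X \<in> G \<Longrightarrow> X \<in> cgen U G"
| cgen_diag: "k < 3 \<Longrightarrow> l < 3 \<Longrightarrow> diag U k l \<in> cgen U G"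
| cgen_compl: "X \<in> cgen U G \<Longrightarrow> cube U - X \<in> cgen U G"
| cgen_cyl: "X \<in> cgen U G \<Longrightarrow> k < 3 \<Longrightarrow> cyl U k X \<in> cgen U G"
| cgen_Union: "(\<And>X. X \<in> S \<Longrightarrow> X \<in> cgen U G) \<Longrightarrow> \<Union>S \<in> cgen U G"

record 'b ca =
  ccar :: "'b set"
  cplus :: "'b \<Rightarrow> 'b \<Rightarrow> 'b"
  ccompl :: "'b \<Rightarrow> 'b"
  ccyl :: "nat \<Rightarrow> 'b \<Rightarrow> 'b"
  cdiag :: "nat \<Rightarrow> nat \<Rightarrow> 'b"

definition Rl :: "'u set \<Rightarrow> ('u \<times> 'u \<times> 'u) set \<Rightarrow> ('u \<times> 'u \<times> 'u) set set
                  \<Rightarrow> ('u \<times> 'u \<times> 'u) set ca" where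
  "Rl U V C = \<lparr>ccar = {X \<in> C. X \<subseteq> V}, cplus = (\<union>), ccompl = (\<lambda>X. V - X),
               ccyl = (\<lambda>k X. V \<inter> cyl U k X), cdiag = (\<lambda>k l. V \<inter> diag U k l)\<rparr>"

definition cmeet :: "'b ca \<Rightarrow> 'b \<Rightarrow> 'b \<Rightarrow> 'b" where
  "cmeet D x y = ccompl D (cplus D (ccompl D x) (ccompl D y))"

definition Ra :: "'b ca \<Rightarrow> 'b wa_alg" where
  "Ra D = \<lparr>wcar = {x \<in> ccar D. ccyl D 2 x = x},
           wplus = cplus D,
           wcompl = ccompl D,
           wcomp = (\<lambda>x y. ccyl D 2 (cmeet D (ccyl D 1 (cmeet D (cdiag D 1 2) x))
                                             (ccyl D 0 (cmeet D (cdiag D 0 2) y)))),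
           wconv = (\<lambda>x. ccyl D 2 (cmeet D (cdiag D 2 0)
                          (ccyl D 0 (cmeet D (cdiag D 0 1) (ccyl D 1 (cmeet D (cdiag D 1 2) x)))))),
           wid = cdiag D 0 1\<rparr>"

definition set_atoms :: "'b set set \<Rightarrow> 'b set set" where
  "set_atoms S = {X \<in> S. X \<noteq> {} \<and> (\<forall>Y\<in>S. Y \<subseteq> X \<longrightarrow> Y = {} \<or> Y = X)}"

end

theory Submission
  imports Defs
begin

text \<open>
  Trails form, for each start vertex, a tree of triangles in which neighbours along an edge of colour
  \<open>k\<close> share the points other than \<open>k\<close>. Walking back along a freely reduced trail gives each point a
  normal form, from which one reads off that two points determine the atom labelling the edge between
  them. Hence cylindrification and diagonals, relativized to \<open>VB A\<close>, act on unions of sets \<open>RB A t\<close>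
  exactly as in the complex algebra of the suitable structure, and the isomorphism follows from the
  arithmetic of atoms; weak associativity enters only through the uniqueness of the domain of an atom.
  Conversely, left translation of trails yields automorphisms of the point set that act transitively
  on each \<open>RB A t\<close>. Every completely generated set is invariant under them, so it contains
  \<open>RB A t\<close> or is disjoint from it.
\<close>

text \<open>Trail equivalence is generated by rewriting in both directions, so telling two points
  apart requires an invariant. It is \<open>node\<close>: the stack absorbs rule (a), the descent in
  \<open>canon\<close> absorbs (b), and its insensitivity to indices related by \<open>suitE\<close>
  absorbs (c). Equivalences in the positive direction are always exhibited by explicit steps.

  A second obstacle is that \<open>cgen\<close> is formed in the full cube, where cylindrification
  leaves \<open>VB A\<close>. Closure of the unions of the \<open>RB A t\<close> under relativized
  operations therefore says nothing about a generated set that happens to lie inside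
  \<open>VB A\<close>; the symmetries supply that bound. Trails have no common start, and
  equivalence preserves the start vertex, so a translation prefixes only the trails from one vertex
  and needs a second prefix that undoes it up to equivalence.

  Completeness of \<open>A\<close> is what makes \<open>x \<mapsto> RU A (edge_below 2 x)\<close>
  surjective: a set of atoms must have a supremum.\<close>

locale weakly_associative =
  fixes A :: "('a, 'm) wa_alg_scheme"
  assumes wa: "is_wa A"
begin

abbreviation add (infixl "\<oplus>" 65) where "x \<oplus> y \<equiv> wplus A x y"
abbreviation mul (infixl "\<odot>" 70) where "x \<odot> y \<equiv> wcomp A x y"
abbreviation neg ("\<ominus> _" [81] 81) where "\<ominus> x \<equiv> wcompl A x"
abbreviation cnv ("_\<acute>" [1000] 1000) where "x\<acute> \<equiv> wconv A x"
abbreviation meet (infixl "\<otimes>" 70) where "x \<otimes> y \<equiv> wmeet A x y"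
abbreviation leq (infix "\<preceq>" 50) where "x \<preceq> y \<equiv> wle A x y"
abbreviation top' ("\<one>") where "\<one> \<equiv> wone A"
abbreviation bot' ("\<zero>") where "\<zero> \<equiv> wzero A"
abbreviation ident ("\<e>") where "\<e> \<equiv> wid A"
abbreviation car ("\<K>") where "\<K> \<equiv> wcar A"

lemma id_closed [simp, intro]: "\<e> \<in> \<K>"
  using wa unfolding is_wa_def by blast

lemma add_closed [simp, intro]: "x \<in> \<K> \<Longrightarrow> y \<in> \<K> \<Longrightarrow> x \<oplus> y \<in> \<K>"
  using wa unfolding is_wa_def by blast

lemma mul_closed [simp, intro]: "x \<in> \<K> \<Longrightarrow> y \<in> \<K> \<Longrightarrow> x \<odot> y \<in> \<K>"
  using wa unfolding is_wa_def by blast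

lemma neg_closed [simp, intro]: "x \<in> \<K> \<Longrightarrow> \<ominus> x \<in> \<K>"
  using wa unfolding is_wa_def by blast

lemma cnv_closed [simp, intro]: "x \<in> \<K> \<Longrightarrow> x\<acute> \<in> \<K>"
  using wa unfolding is_wa_def by blast

lemma meet_closed [simp, intro]: "x \<in> \<K> \<Longrightarrow> y \<in> \<K> \<Longrightarrow> x \<otimes> y \<in> \<K>"
  by (simp add: wmeet_def)

lemma one_closed [simp, intro]: "\<one> \<in> \<K>"
  by (simp add: wone_def wdiv_def)

lemma zero_closed [simp, intro]: "\<zero> \<in> \<K>"
  by (simp add: wzero_def)

lemma add_comm: "x \<in> \<K> \<Longrightarrow> y \<in> \<K> \<Longrightarrow> x \<oplus> y = y \<oplus> x"
  using wa unfolding is_wa_def by blast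

lemma add_assoc': "x \<in> \<K> \<Longrightarrow> y \<in> \<K> \<Longrightarrow> z \<in> \<K> \<Longrightarrow> x \<oplus> (y \<oplus> z) = x \<oplus> y \<oplus> z"
  using wa unfolding is_wa_def by blast

lemma add_assoc: "x \<in> \<K> \<Longrightarrow> y \<in> \<K> \<Longrightarrow> z \<in> \<K> \<Longrightarrow> x \<oplus> y \<oplus> z = x \<oplus> (y \<oplus> z)"
  by (simp add: add_assoc')

lemma add_left_comm: "x \<in> \<K> \<Longrightarrow> y \<in> \<K> \<Longrightarrow> z \<in> \<K> \<Longrightarrow> x \<oplus> (y \<oplus> z) = y \<oplus> (x \<oplus> z)"
  by (metis add_assoc add_comm)

lemmas add_ac = add_assoc add_comm add_left_comm

lemma huntington: "x \<in> \<K> \<Longrightarrow> y \<in> \<K> \<Longrightarrow> \<ominus> (\<ominus> x \<oplus> \<ominus> y) \<oplus> \<ominus> (\<ominus> x \<oplus> y) = x"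
  using wa unfolding is_wa_def by blast

lemma weak_assoc: "x \<in> \<K> \<Longrightarrow> (x \<otimes> \<e>) \<odot> \<one> \<odot> \<one> = (x \<otimes> \<e>) \<odot> \<one>"
  using wa unfolding is_wa_def by blast

lemma mul_distrib_right: "x \<in> \<K> \<Longrightarrow> y \<in> \<K> \<Longrightarrow> z \<in> \<K> \<Longrightarrow> (x \<oplus> y) \<odot> z = x \<odot> z \<oplus> y \<odot> z"
  using wa unfolding is_wa_def by blast

lemma mul_id_right [simp]: "x \<in> \<K> \<Longrightarrow> x \<odot> \<e> = x"
  using wa unfolding is_wa_def by blast

lemma cnv_cnv [simp]: "x \<in> \<K> \<Longrightarrow> x\<acute>\<acute> = x"
  using wa unfolding is_wa_def by blast

lemma cnv_add: "x \<in> \<K> \<Longrightarrow> y \<in> \<K> \<Longrightarrow> (x \<oplus> y)\<acute> = x\<acute> \<oplus> y\<acute>"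
  using wa unfolding is_wa_def by blast

lemma cnv_mul: "x \<in> \<K> \<Longrightarrow> y \<in> \<K> \<Longrightarrow> (x \<odot> y)\<acute> = y\<acute> \<odot> x\<acute>"
  using wa unfolding is_wa_def by blast

lemma tarski: "x \<in> \<K> \<Longrightarrow> y \<in> \<K> \<Longrightarrow> x\<acute> \<odot> \<ominus> (x \<odot> y) \<preceq> \<ominus> y"
  using wa unfolding is_wa_def wle_def by blast

subsection \<open>Boolean algebra from Huntington's axioms\<close>

text \<open>Splitting \<open>x\<close> and its complement along \<open>y\<close> with Huntington's
  equation gives four terms whose sum is symmetric in \<open>x\<close> and \<open>y\<close>.\<close>

lemma excluded_middle_unique:
  assumes "x \<in> \<K>" "y \<in> \<K>"
  shows "x \<oplus> \<ominus> x = y \<oplus> \<ominus> y"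
proof -
  let ?f = "\<lambda>a b. \<ominus> (a \<oplus> b)"
  have "x \<oplus> \<ominus> x = ?f (\<ominus> x) (\<ominus> \<ominus> y) \<oplus> ?f (\<ominus> x) (\<ominus> y)
      \<oplus> (?f (\<ominus> \<ominus> x) (\<ominus> \<ominus> y) \<oplus> ?f (\<ominus> \<ominus> x) (\<ominus> y))"
    using assms huntington[of x "\<ominus> y"] huntington[of "\<ominus> x" "\<ominus> y"] by simp
  also have "\<dots> = ?f (\<ominus> y) (\<ominus> \<ominus> x) \<oplus> ?f (\<ominus> y) (\<ominus> x)
      \<oplus> (?f (\<ominus> \<ominus> y) (\<ominus> \<ominus> x) \<oplus> ?f (\<ominus> \<ominus> y) (\<ominus> x))"
    using assms by (simp add: add_ac)
  also have "\<dots> = y \<oplus> \<ominus> y"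
    using assms huntington[of y "\<ominus> x"] huntington[of "\<ominus> y" "\<ominus> x"] by simp
  finally show ?thesis .
qed

lemma add_neg [simp]: "x \<in> \<K> \<Longrightarrow> x \<oplus> \<ominus> x = \<one>"
  using excluded_middle_unique[of x "\<e>"] by (simp add: wone_def wdiv_def)

lemma neg_add [simp]: "x \<in> \<K> \<Longrightarrow> \<ominus> x \<oplus> x = \<one>"
  using add_neg[of x] by (simp add: add_comm)

lemma neg_one: "\<ominus> \<one> = \<zero>"
  by (simp add: wzero_def)

text \<open>Both sides are the same complement joined with \<open>\<zero>\<close>, so the unit law
  for \<open>\<zero>\<close>, which is derived only later, can be avoided.\<close>

lemma neg_neg [simp]:
  assumes "x \<in> \<K>"
  shows "\<ominus> \<ominus> x = x"
proof -
  have "x = \<ominus> (\<ominus> x \<oplus> \<ominus> \<ominus> \<ominus> x) \<oplus> \<zero>"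
    using assms huntington[of x "\<ominus> \<ominus> x"] by (simp add: neg_one)
  moreover have "\<ominus> \<ominus> x = \<zero> \<oplus> \<ominus> (\<ominus> \<ominus> \<ominus> x \<oplus> \<ominus> x)"
    using assms huntington[of "\<ominus> \<ominus> x" "\<ominus> x"] by (simp add: neg_one)
  ultimately show ?thesis
    using assms by (simp add: add_comm)
qed

lemma neg_zero: "\<ominus> \<zero> = \<one>"
  by (simp add: wzero_def)

lemma one_add_zero: "\<one> \<oplus> \<zero> = \<one>"
  using add_neg[of \<one>] by (simp add: neg_one)

lemma one_add_one: "\<one> \<oplus> \<one> = \<one>"
proof -
  have "\<zero> = \<zero> \<oplus> \<ominus> (\<one> \<oplus> \<one>)"
    using huntington[of \<zero> \<one>] by (simp add: neg_one neg_zero one_add_zero)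
  \<comment> \<open>Adding \<open>\<one>\<close> to the previous equation; adding it once more makes
    the right side an excluded middle for \<open>\<one> \<oplus> \<one>\<close>.\<close>
  then have "\<one> = \<one> \<oplus> \<ominus> (\<one> \<oplus> \<one>)"
    using one_add_zero by (metis add_assoc neg_closed add_closed one_closed zero_closed)
  then have "\<one> \<oplus> \<one> = \<one> \<oplus> \<one> \<oplus> \<ominus> (\<one> \<oplus> \<one>)"
    by (metis add_assoc neg_closed add_closed one_closed)
  then show ?thesis by simp
qed

lemma add_zero [simp]:
  assumes "x \<in> \<K>"
  shows "x \<oplus> \<zero> = x"
proof -
  have x: "x = \<ominus> (\<ominus> x \<oplus> \<ominus> x) \<oplus> \<zero>"
    using huntington[of x x] assms by (simp add: neg_one)
  have "\<zero> \<oplus> \<zero> = \<zero>"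
    using huntington[of \<zero> \<one>] by (simp add: neg_one neg_zero one_add_zero one_add_one)
  then show ?thesis
    using x assms by (metis add_assoc neg_closed add_closed zero_closed)
qed

lemma add_idem [simp]:
  assumes "x \<in> \<K>"
  shows "x \<oplus> x = x"
proof -
  have "\<ominus> (x \<oplus> x) = \<ominus> x"
    using huntington[of "\<ominus> x" "\<ominus> x"] assms by (simp add: neg_one)
  then show ?thesis
    using assms by (metis add_closed neg_neg)
qed

lemma leq_refl [simp]: "x \<in> \<K> \<Longrightarrow> x \<preceq> x"
  by (simp add: wle_def)

lemma leq_trans: "x \<preceq> y \<Longrightarrow> y \<preceq> z \<Longrightarrow> x \<in> \<K> \<Longrightarrow> y \<in> \<K> \<Longrightarrow> z \<in> \<K> \<Longrightarrow> x \<preceq> z"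
  unfolding wle_def by (metis add_assoc)

lemma leq_antisym: "x \<preceq> y \<Longrightarrow> y \<preceq> x \<Longrightarrow> x \<in> \<K> \<Longrightarrow> y \<in> \<K> \<Longrightarrow> x = y"
  unfolding wle_def by (metis add_comm)

lemma leq_add1: "x \<in> \<K> \<Longrightarrow> y \<in> \<K> \<Longrightarrow> x \<preceq> x \<oplus> y"
  unfolding wle_def by (metis add_assoc add_idem)

lemma leq_add2: "x \<in> \<K> \<Longrightarrow> y \<in> \<K> \<Longrightarrow> y \<preceq> x \<oplus> y"
  by (metis leq_add1 add_comm)

lemma add_least: "x \<preceq> z \<Longrightarrow> y \<preceq> z \<Longrightarrow> x \<in> \<K> \<Longrightarrow> y \<in> \<K> \<Longrightarrow> z \<in> \<K> \<Longrightarrow> x \<oplus> y \<preceq> z"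
  unfolding wle_def by (simp add: add_assoc)

lemma leq_one [simp]: "x \<in> \<K> \<Longrightarrow> x \<preceq> \<one>"
  using leq_add1[of x "\<ominus> x"] by simp

lemma zero_leq [simp]: "x \<in> \<K> \<Longrightarrow> \<zero> \<preceq> x"
  unfolding wle_def by (simp add: add_comm)

lemma neg_antimono:
  assumes "x \<preceq> y" "x \<in> \<K>" "y \<in> \<K>"
  shows "\<ominus> y \<preceq> \<ominus> x"
proof -
  have "\<ominus> (x \<oplus> \<ominus> y) \<oplus> \<ominus> y = \<ominus> x"
    using huntington[of "\<ominus> x" y] assms by (simp add: wle_def)
  then show ?thesis
    using leq_add2[of "\<ominus> (x \<oplus> \<ominus> y)" "\<ominus> y"] assms by simp
qed

lemma meet_leq1: "x \<in> \<K> \<Longrightarrow> y \<in> \<K> \<Longrightarrow> x \<otimes> y \<preceq> x"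
  using neg_antimono[of "\<ominus> x" "\<ominus> x \<oplus> \<ominus> y"] leq_add1[of "\<ominus> x" "\<ominus> y"]
  by (simp add: wmeet_def)

lemma meet_leq2: "x \<in> \<K> \<Longrightarrow> y \<in> \<K> \<Longrightarrow> x \<otimes> y \<preceq> y"
  using neg_antimono[of "\<ominus> y" "\<ominus> x \<oplus> \<ominus> y"] leq_add2[of "\<ominus> x" "\<ominus> y"]
  by (simp add: wmeet_def)

lemma meet_greatest:
  "z \<preceq> x \<Longrightarrow> z \<preceq> y \<Longrightarrow> x \<in> \<K> \<Longrightarrow> y \<in> \<K> \<Longrightarrow> z \<in> \<K> \<Longrightarrow> z \<preceq> x \<otimes> y"
  using neg_antimono[of "\<ominus> x \<oplus> \<ominus> y" "\<ominus> z"]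
    add_least[of "\<ominus> x" "\<ominus> z" "\<ominus> y"] neg_antimono[of z x] neg_antimono[of z y]
  by (simp add: wmeet_def)

lemma meet_split: "x \<in> \<K> \<Longrightarrow> y \<in> \<K> \<Longrightarrow> x = (x \<otimes> y) \<oplus> (x \<otimes> \<ominus> y)"
  using huntington[of x y] by (simp add: wmeet_def)

lemma meet_neg_zero: "x \<in> \<K> \<Longrightarrow> x \<otimes> \<ominus> x = \<zero>"
  by (simp add: wmeet_def neg_one)

lemma leq_of_meet_neg:
  assumes "x \<otimes> \<ominus> y = \<zero>" "x \<in> \<K>" "y \<in> \<K>"
  shows "x \<preceq> y"
  using meet_split[of x y] meet_leq2[of x y] assms by simp

subsection \<open>Atoms\<close>

lemma AtI: "a \<in> \<K> \<Longrightarrow> a \<noteq> \<zero> \<Longrightarrow> (\<And>y. y \<in> \<K> \<Longrightarrow> y \<preceq> a \<Longrightarrow> y = \<zero> \<or> y = a) \<Longrightarrow> a \<in> wa_At A"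
  by (simp add: wa_At_def wa_atom_def)

lemma leq_At: "y \<preceq> a \<Longrightarrow> a \<in> wa_At A \<Longrightarrow> y \<in> \<K> \<Longrightarrow> y = \<zero> \<or> y = a"
  by (simp add: wa_At_def wa_atom_def)

lemma At_nonzero: "a \<in> wa_At A \<Longrightarrow> a \<noteq> \<zero>"
  by (simp add: wa_At_def wa_atom_def)

lemma At_closed [simp, intro]: "a \<in> wa_At A \<Longrightarrow> a \<in> \<K>"
  by (simp add: wa_At_def wa_atom_def)

lemma leq_zero: "x \<preceq> \<zero> \<Longrightarrow> x \<in> \<K> \<Longrightarrow> x = \<zero>"
  using leq_antisym zero_leq by blast

lemma At_leq_At: "a \<preceq> b \<Longrightarrow> a \<in> wa_At A \<Longrightarrow> b \<in> wa_At A \<Longrightarrow> a = b"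
  using leq_At[of a b] At_nonzero by blast

lemma At_neg_iff:
  assumes a: "a \<in> wa_At A" and x: "x \<in> \<K>"
  shows "a \<preceq> \<ominus> x \<longleftrightarrow> \<not> a \<preceq> x"
proof
  assume "a \<preceq> \<ominus> x"
  then have "a \<preceq> x \<Longrightarrow> a \<preceq> \<zero>"
    using meet_greatest[of a x "\<ominus> x"] a x by (simp add: meet_neg_zero)
  then show "\<not> a \<preceq> x"
    using leq_zero a At_nonzero by blast
next
  assume n: "\<not> a \<preceq> x"
  have "a \<otimes> x = \<zero> \<or> a \<otimes> x = a"
    using a x leq_At[OF meet_leq1[of a x]] by simp
  then have "a \<otimes> \<ominus> \<ominus> x = \<zero>"
    using n meet_leq2[of a x] a x by auto
  then show "a \<preceq> \<ominus> x"
    using a x leq_of_meet_neg[of a "\<ominus> x"] by simp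
qed

lemma At_add_iff:
  assumes a: "a \<in> wa_At A" and xy: "x \<in> \<K>" "y \<in> \<K>"
  shows "a \<preceq> x \<oplus> y \<longleftrightarrow> a \<preceq> x \<or> a \<preceq> y"
proof
  assume "a \<preceq> x \<oplus> y"
  moreover have "\<not> a \<preceq> x \<Longrightarrow> \<not> a \<preceq> y \<Longrightarrow> a \<preceq> \<ominus> (x \<oplus> y)"
    using At_neg_iff[OF a, of x] At_neg_iff[OF a, of y] meet_greatest[of a "\<ominus> x" "\<ominus> y"] xy a
    by (simp add: wmeet_def)
  ultimately show "a \<preceq> x \<or> a \<preceq> y"
    using At_neg_iff[OF a, of "x \<oplus> y"] xy by blast
next
  assume "a \<preceq> x \<or> a \<preceq> y"
  then show "a \<preceq> x \<oplus> y"
    using leq_trans[OF _ leq_add1] leq_trans[OF _ leq_add2] a xy by blast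
qed

lemma At_meet_iff:
  "a \<in> wa_At A \<Longrightarrow> x \<in> \<K> \<Longrightarrow> y \<in> \<K> \<Longrightarrow> a \<preceq> x \<otimes> y \<longleftrightarrow> a \<preceq> x \<and> a \<preceq> y"
  by (simp add: wmeet_def At_neg_iff At_add_iff)

subsection \<open>Composition and converse\<close>

lemma mul_mono_left: "x \<preceq> y \<Longrightarrow> x \<in> \<K> \<Longrightarrow> y \<in> \<K> \<Longrightarrow> z \<in> \<K> \<Longrightarrow> x \<odot> z \<preceq> y \<odot> z"
  unfolding wle_def by (metis mul_distrib_right)

lemma cnv_mono: "x \<preceq> y \<Longrightarrow> x \<in> \<K> \<Longrightarrow> y \<in> \<K> \<Longrightarrow> x\<acute> \<preceq> y\<acute>"
  unfolding wle_def by (metis cnv_add)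

lemma cnv_leq_swap: "x \<in> \<K> \<Longrightarrow> y \<in> \<K> \<Longrightarrow> x\<acute> \<preceq> y \<longleftrightarrow> x \<preceq> y\<acute>"
  by (metis cnv_mono cnv_cnv cnv_closed)

text \<open>The axioms distribute only from the right; converse reverses products and carries
  monotonicity to the other side.\<close>

lemma mul_mono_right:
  assumes "x \<preceq> y" "x \<in> \<K>" "y \<in> \<K>" "z \<in> \<K>"
  shows "z \<odot> x \<preceq> z \<odot> y"
proof -
  have "(z \<odot> x)\<acute> \<preceq> (z \<odot> y)\<acute>"
    using assms by (simp add: cnv_mul mul_mono_left cnv_mono)
  then show ?thesis using assms by (simp add: cnv_leq_swap)
qed

lemma mul_mono:
  assumes "x \<preceq> y" "x' \<preceq> y'" "x \<in> \<K>" "y \<in> \<K>" "x' \<in> \<K>" "y' \<in> \<K>"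
  shows "x \<odot> x' \<preceq> y \<odot> y'"
  using leq_trans[OF mul_mono_left[of x y x'] mul_mono_right[of x' y' y]] assms by simp

lemma cnv_zero: "\<zero>\<acute> = \<zero>"
  using cnv_leq_swap[of \<zero> \<zero>] leq_zero[of "\<zero>\<acute>"] by simp

lemma cnv_id [simp]: "\<e>\<acute> = \<e>"
  using cnv_mul[of "\<e>\<acute>" \<e>] by simp

lemma mul_id_left [simp]: "x \<in> \<K> \<Longrightarrow> \<e> \<odot> x = x"
  using cnv_mul[of "x\<acute>" \<e>] by simp

lemma cnv_At [simp, intro]:
  assumes a: "a \<in> wa_At A"
  shows "a\<acute> \<in> wa_At A"
proof -
  have "y = \<zero> \<or> y = a\<acute>" if y: "y \<in> \<K>" "y \<preceq> a\<acute>" for y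
  proof -
    have "y\<acute> \<preceq> a" using y a by (simp add: cnv_leq_swap)
    then have "y\<acute> = \<zero> \<or> y\<acute> = a"
      using leq_At a y by blast
    then show ?thesis using y by (metis cnv_cnv cnv_zero)
  qed
  moreover have "a\<acute> \<noteq> \<zero>"
    using At_nonzero[OF a] a by (metis At_closed cnv_cnv cnv_zero)
  ultimately show ?thesis
    using a by (intro AtI) auto
qed

text \<open>A Peircean law, by contraposition of \<open>tarski\<close>: if \<open>b\<close> missed
  \<open>x\<acute> \<odot> c\<close>, then \<open>x \<odot> b\<close> would lie below
  \<open>\<ominus> c\<close>. That \<open>b\<close> and \<open>c\<close> are atoms turns failure of
  \<open>\<preceq>\<close> into disjointness; \<open>x\<close> may be arbitrary.\<close>

lemma triangle:
  assumes "c \<preceq> x \<odot> b" "x \<in> \<K>" "b \<in> wa_At A" "c \<in> wa_At A"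
  shows "b \<preceq> x\<acute> \<odot> c"
proof (rule ccontr)
  assume "\<not> b \<preceq> x\<acute> \<odot> c"
  then have "b \<preceq> \<ominus> (x\<acute> \<odot> c)"
    using assms by (simp add: At_neg_iff)
  then have "x \<odot> b \<preceq> x \<odot> \<ominus> (x\<acute> \<odot> c)"
    using assms by (simp add: mul_mono_right)
  moreover have "x \<odot> \<ominus> (x\<acute> \<odot> c) \<preceq> \<ominus> c"
    using tarski[of "x\<acute>" c] assms by simp
  ultimately have "x \<odot> b \<preceq> \<ominus> c"
    using leq_trans assms by (meson At_closed cnv_closed mul_closed neg_closed)
  then have "c \<preceq> \<ominus> c"
    using leq_trans assms by (meson At_closed mul_closed neg_closed)
  then show False using assms by (simp add: At_neg_iff)
qed

lemma cnv_triangle: "c \<preceq> x \<odot> y \<Longrightarrow> c \<in> \<K> \<Longrightarrow> x \<in> \<K> \<Longrightarrow> y \<in> \<K> \<Longrightarrow> c\<acute> \<preceq> y\<acute> \<odot> x\<acute>"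
  by (simp add: cnv_leq_swap cnv_mul)

lemma triangle':
  assumes "c \<preceq> a \<odot> y" "y \<in> \<K>" "a \<in> wa_At A" "c \<in> wa_At A"
  shows "a \<preceq> c \<odot> y\<acute>"
proof -
  have "a\<acute> \<preceq> y\<acute>\<acute> \<odot> c\<acute>"
    using triangle[OF cnv_triangle[OF assms(1)]] assms by auto
  then show ?thesis
    using assms by (simp add: cnv_leq_swap cnv_mul)
qed

end

locale atomic_weakly_associative = weakly_associative +
  assumes atomic: "wa_atomic A"
begin

lemma ex_At: "x \<in> \<K> \<Longrightarrow> x \<noteq> \<zero> \<Longrightarrow> \<exists>a\<in>wa_At A. a \<preceq> x"
  using atomic unfolding wa_atomic_def wa_At_def by blast

lemma leq_by_At:
  assumes "\<And>a. a \<in> wa_At A \<Longrightarrow> a \<preceq> x \<Longrightarrow> a \<preceq> y" "x \<in> \<K>" "y \<in> \<K>"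
  shows "x \<preceq> y"
proof (rule ccontr)
  assume "\<not> x \<preceq> y"
  then have "x \<otimes> \<ominus> y \<noteq> \<zero>"
    using leq_of_meet_neg assms by blast
  then obtain a where "a \<in> wa_At A" "a \<preceq> x \<otimes> \<ominus> y"
    using ex_At[of "x \<otimes> \<ominus> y"] assms by auto
  then show False using assms by (metis At_meet_iff At_neg_iff neg_closed)
qed

lemma eq_by_At:
  "(\<And>a. a \<in> wa_At A \<Longrightarrow> a \<preceq> x \<longleftrightarrow> a \<preceq> y) \<Longrightarrow> x \<in> \<K> \<Longrightarrow> y \<in> \<K> \<Longrightarrow> x = y"
  by (rule leq_antisym; (rule leq_by_At)?) simp_all

text \<open>Stands in for complete additivity of composition: were all of \<open>y\<close> disjoint
  from \<open>x\<acute> \<odot> c\<close>, \<open>tarski\<close> would force \<open>c\<close> below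
  its own complement. So some atom of \<open>y\<close> lies below that product, and
  \<open>triangle\<close> turns it around.\<close>

lemma mul_decomp_right:
  assumes c: "c \<in> wa_At A" "c \<preceq> x \<odot> y" and xy: "x \<in> \<K>" "y \<in> \<K>"
  obtains b where "b \<in> wa_At A" "b \<preceq> y" "c \<preceq> x \<odot> b"
proof -
  have "\<not> y \<preceq> \<ominus> (x\<acute> \<odot> c)"
  proof
    assume "y \<preceq> \<ominus> (x\<acute> \<odot> c)"
    then have "x \<odot> y \<preceq> x \<odot> \<ominus> (x\<acute> \<odot> c)"
      using c xy by (simp add: mul_mono_right)
    moreover have "x \<odot> \<ominus> (x\<acute> \<odot> c) \<preceq> \<ominus> c"
      using tarski[of "x\<acute>" c] c xy by simp
    ultimately have "c \<preceq> \<ominus> c"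
      using leq_trans c xy by (meson At_closed cnv_closed mul_closed neg_closed)
    then show False using c by (simp add: At_neg_iff)
  qed
  then obtain b where b: "b \<in> wa_At A" "b \<preceq> y" "\<not> b \<preceq> \<ominus> (x\<acute> \<odot> c)"
    using leq_by_At[of y "\<ominus> (x\<acute> \<odot> c)"] c xy by auto
  then have "b \<preceq> x\<acute> \<odot> c" using c xy by (simp add: At_neg_iff)
  then have "c \<preceq> x \<odot> b" using triangle[of b "x\<acute>" c] b c xy by simp
  then show thesis using b that by blast
qed

lemma mul_decomp_left:
  assumes c: "c \<in> wa_At A" "c \<preceq> x \<odot> y" and xy: "x \<in> \<K>" "y \<in> \<K>"
  obtains a where "a \<in> wa_At A" "a \<preceq> x" "c \<preceq> a \<odot> y"
proof -
  obtain b where b: "b \<in> wa_At A" "b \<preceq> x\<acute>" "c\<acute> \<preceq> y\<acute> \<odot> b"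
    using mul_decomp_right[of "c\<acute>" "y\<acute>" "x\<acute>"] cnv_triangle[OF c(2)] c xy by auto
  then have "c \<preceq> b\<acute> \<odot> y" "b\<acute> \<preceq> x"
    using c xy by (auto simp add: cnv_leq_swap cnv_mul)
  then show thesis using that b by blast
qed

lemma mul_decomp:
  assumes c: "c \<in> wa_At A" "c \<preceq> x \<odot> y" and xy: "x \<in> \<K>" "y \<in> \<K>"
  obtains a b where "a \<in> wa_At A" "b \<in> wa_At A" "a \<preceq> x" "b \<preceq> y" "c \<preceq> a \<odot> b"
proof -
  obtain a where a: "a \<in> wa_At A" "a \<preceq> x" "c \<preceq> a \<odot> y"
    using mul_decomp_left[OF c xy] .
  obtain b where "b \<in> wa_At A" "b \<preceq> y" "c \<preceq> a \<odot> b"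
    using mul_decomp_right[OF c(1) a(3)] a xy by blast
  then show thesis using that a by blast
qed

subsection \<open>Identity atoms and domains\<close>

definition idAt :: "'a set" where
  "idAt = {u \<in> wa_At A. u \<preceq> \<e>}"

lemma idAt_leq: "u \<in> idAt \<Longrightarrow> u \<preceq> \<e>"
  by (simp add: idAt_def)

lemma idAtI: "u \<in> wa_At A \<Longrightarrow> u \<preceq> \<e> \<Longrightarrow> u \<in> idAt"
  by (simp add: idAt_def)

lemma idAt_At [simp, intro]: "u \<in> idAt \<Longrightarrow> u \<in> wa_At A"
  by (simp add: idAt_def)

lemma idAt_mul_left: "a \<preceq> u \<odot> b \<Longrightarrow> u \<preceq> \<e> \<Longrightarrow> u \<in> wa_At A \<Longrightarrow> a \<in> wa_At A \<Longrightarrow> b \<in> wa_At A \<Longrightarrow> a = b"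
  using mul_mono_left[of u \<e> b] leq_trans[of a "u \<odot> b" b] At_leq_At by auto

lemma idAt_mul_right: "a \<preceq> b \<odot> u \<Longrightarrow> u \<preceq> \<e> \<Longrightarrow> u \<in> wa_At A \<Longrightarrow> a \<in> wa_At A \<Longrightarrow> b \<in> wa_At A \<Longrightarrow> a = b"
  using mul_mono_right[of u \<e> b] leq_trans[of a "b \<odot> u" b] At_leq_At by auto

lemma ex_dom:
  assumes a: "a \<in> wa_At A"
  obtains u where "u \<in> idAt" "a \<preceq> u \<odot> a"
proof -
  have "a \<preceq> \<e> \<odot> a" using a by simp
  then obtain u where "u \<in> wa_At A" "u \<preceq> \<e>" "a \<preceq> u \<odot> a"
    using mul_decomp_left[OF a] a by blast
  then show thesis using that idAtI by blast
qed

lemma weak_assoc_idAt: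
  assumes u: "u \<in> idAt"
  shows "u \<odot> \<one> \<odot> \<one> = u \<odot> \<one>"
proof -
  have "u \<otimes> \<e> = u"
    using u leq_antisym[of u "u \<otimes> \<e>"] meet_leq1[of u \<e>] meet_greatest[of u u \<e>] by (simp add: idAt_leq)
  then show ?thesis using weak_assoc[of u] u by auto
qed

lemma leq_mul_one: "a \<preceq> x \<odot> y \<Longrightarrow> a \<in> \<K> \<Longrightarrow> x \<in> \<K> \<Longrightarrow> y \<in> \<K> \<Longrightarrow> a \<preceq> x \<odot> \<one>"
  using leq_trans[OF _ mul_mono_right[of y \<one> x]] by simp

text \<open>This is where weak associativity acts: \<open>a \<odot> y\<close> lies below
  \<open>u \<odot> \<one> \<odot> \<one>\<close>, which collapses to
  \<open>u \<odot> \<one>\<close>.\<close>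

lemma dom_absorb:
  assumes "c \<preceq> a \<odot> y" "a \<preceq> u \<odot> \<one>" "u \<in> idAt" "a \<in> \<K>" "c \<in> \<K>" "y \<in> \<K>"
  shows "c \<preceq> u \<odot> \<one>"
proof -
  have "a \<odot> y \<preceq> u \<odot> \<one> \<odot> \<one>"
    using assms by (intro mul_mono) auto
  then show ?thesis
    using assms leq_trans[of c "a \<odot> y"] by (simp add: weak_assoc_idAt)
qed

text \<open>Turning a triangle \<open>a \<preceq> u \<odot> b\<close> around puts \<open>u\<close>
  below \<open>a \<odot> b\<acute>\<close>, hence below \<open>v \<odot> \<one>\<close>. Then
  \<open>u \<preceq> v \<odot> c\<close> for an atom \<open>c\<close>; since \<open>v\<close> is
  below \<open>\<e>\<close> this gives \<open>c = u\<close>, and since \<open>u\<close> is below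
  \<open>\<e>\<close> it gives \<open>u = v\<close>.\<close>

lemma idAt_dom_unique:
  assumes u: "u \<in> idAt" "v \<in> idAt" and a: "a \<in> wa_At A" "a \<preceq> u \<odot> \<one>" "a \<preceq> v \<odot> \<one>"
  shows "u = v"
proof -
  obtain b where b: "b \<in> wa_At A" "a \<preceq> u \<odot> b"
    using mul_decomp_right[OF a(1,2)] u by blast
  have "u \<preceq> a \<odot> b\<acute>"
    using triangle'[OF b(2)] a b u by auto
  then have "u \<preceq> v \<odot> \<one>"
    using dom_absorb[of u a "b\<acute>" v] a b u by auto
  then obtain c where c: "c \<in> wa_At A" "u \<preceq> v \<odot> c"
    using mul_decomp_right[of u v \<one>] u by blast
  then have "u = c"
    using idAt_mul_left[of u v c] u by (simp add: idAt_leq)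
  then have "u \<preceq> v \<odot> u" using c by simp
  then have "u = v"
    using idAt_mul_right[of u v u] u by (simp add: idAt_leq)
  then show ?thesis .
qed

text \<open>The condition is phrased with \<open>\<one>\<close> because
  \<open>u \<odot> \<one>\<close> is the shape that weak associativity controls; the range of
  \<open>a\<close> is expressed as \<open>dm (a\<acute>)\<close>.\<close>

definition dm :: "'a \<Rightarrow> 'a" where
  "dm a = (THE u. u \<in> idAt \<and> a \<preceq> u \<odot> \<one>)"

lemma dm_eqI:
  assumes "a \<in> wa_At A" "u \<in> idAt" "a \<preceq> u \<odot> \<one>"
  shows "dm a = u"
  unfolding dm_def using assms idAt_dom_unique by blast

lemma dm:
  assumes "a \<in> wa_At A"
  shows "dm a \<in> idAt" "a \<preceq> dm a \<odot> a" "a \<preceq> dm a \<odot> \<one>"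
proof -
  obtain u where u: "u \<in> idAt" "a \<preceq> u \<odot> a" using ex_dom assms by blast
  then have "a \<preceq> u \<odot> \<one>" using leq_mul_one[OF u(2)] assms by auto
  then have "dm a = u" using dm_eqI u assms by blast
  then show "dm a \<in> idAt" "a \<preceq> dm a \<odot> a" "a \<preceq> dm a \<odot> \<one>"
    using u \<open>a \<preceq> u \<odot> \<one>\<close> by auto
qed

lemma dm_At [simp, intro]: "a \<in> wa_At A \<Longrightarrow> dm a \<in> wa_At A"
  using dm(1) by blast

lemma dm_mul:
  assumes "c \<preceq> a \<odot> b" "a \<in> wa_At A" "b \<in> wa_At A" "c \<in> wa_At A"
  shows "dm c = dm a"
  using dom_absorb[OF assms(1) dm(3) dm(1)] assms by (intro dm_eqI) (simp_all add: dm)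

lemma dm_mul_cnv:
  assumes "c \<preceq> a \<odot> b" "a \<in> wa_At A" "b \<in> wa_At A" "c \<in> wa_At A"
  shows "dm (c\<acute>) = dm (b\<acute>)" "dm b = dm (a\<acute>)"
  using dm_mul[OF cnv_triangle[OF assms(1)]] dm_mul[OF triangle[OF assms(1)]] assms by auto

text \<open>Decomposing \<open>u \<preceq> u \<odot> \<e>\<close> shows
  \<open>u \<preceq> u \<odot> u\<close>, which turns into
  \<open>u \<preceq> u\<acute> \<odot> u\<close>; the right factor lies below
  \<open>\<e>\<close>.\<close>

lemma cnv_idAt:
  assumes u: "u \<in> idAt"
  shows "u\<acute> = u"
proof -
  have "u \<preceq> u \<odot> \<e>" using u by auto
  then obtain b where b: "b \<in> wa_At A" "b \<preceq> \<e>" "u \<preceq> u \<odot> b"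
    using mul_decomp_right[of u u \<e>] u by blast
  then have "b = u" using idAt_mul_left[of u u b] u by (simp add: idAt_leq)
  then have "u \<preceq> u\<acute> \<odot> u" using triangle[of u u u] b u by auto
  then show ?thesis using idAt_mul_right[of u "u\<acute>" u] u by (simp add: idAt_leq)
qed

lemma mul_dm_cnv: "a \<in> wa_At A \<Longrightarrow> a \<preceq> a \<odot> dm (a\<acute>)"
  using cnv_triangle[OF dm(2)[of "a\<acute>"]] cnv_idAt[OF dm(1)[of "a\<acute>"]] by auto

lemma dm_leq_mul_cnv: "a \<in> wa_At A \<Longrightarrow> dm a \<preceq> a \<odot> a\<acute>"
  using triangle'[OF dm(2)[of a]] by auto

end

section \<open>Indices below three and components of triples\<close>

lemma less_3_iff: "i < 3 \<longleftrightarrow> i = 0 \<or> i = 1 \<or> i = (2::nat)"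
  by auto

lemma ex_third: "\<exists>m<3. m \<noteq> i \<and> m \<noteq> (j::nat)"
  by presburger

lemma tc_simps [simp]:
  "tc (x, y, z) 0 = x" "tc (x, y, z) (Suc 0) = y" "tc (x, y, z) 2 = z"
  by (simp_all add: tc_def)

lemma tc_eqI:
  assumes "\<And>k. k < 3 \<Longrightarrow> tc s k = tc t k"
  shows "s = t"
  using assms[of 0] assms[of 1] assms[of 2] by (cases s; cases t) simp

lemma suitB_iff:
  "(x, y, z) \<in> suitB A \<longleftrightarrow> x \<in> wa_At A \<and> y \<in> wa_At A \<and> z \<in> wa_At A \<and> wle A y (wcomp A z x)"
  by (auto simp: suitB_def less_3_iff)

lemma suitT_iff: "(s, t) \<in> suitT A k \<longleftrightarrow> s \<in> suitB A \<and> t \<in> suitB A \<and> tc s k = tc t k"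
  by (simp add: suitT_def)

lemma suitE_sub: "s \<in> suitE A k l \<Longrightarrow> s \<in> suitB A"
  by (simp add: suitE_def split: if_splits)

context atomic_weakly_associative
begin

subsection \<open>Triangles as three-point networks of atoms\<close>

text \<open>A triple in \<open>suitB A\<close> is read as a triangle on the points \<open>0, 1, 2\<close>, its component \<open>k\<close>
  labelling the edge opposite to \<open>k\<close> in increasing direction.\<close>

definition lab :: "'a \<times> 'a \<times> 'a \<Rightarrow> nat \<Rightarrow> nat \<Rightarrow> 'a" where
  "lab s i j =
    (if i = j then (if i = 0 then dm (tc s 2) else if i = 1 then dm (tc s 0) else dm ((tc s 0)\<acute>))
     else if i < j then tc s (3 - i - j) else (tc s (3 - i - j))\<acute>)"

lemma suitB_tc: "s \<in> suitB A \<Longrightarrow> k < 3 \<Longrightarrow> tc s k \<in> wa_At A"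
  by (simp add: suitB_def)

lemma lab_At: "s \<in> suitB A \<Longrightarrow> i < 3 \<Longrightarrow> j < 3 \<Longrightarrow> lab s i j \<in> wa_At A"
  by (auto simp: lab_def suitB_tc)

lemma lab_eval:
  "lab (x, y, z) 0 0 = dm z" "lab (x, y, z) (Suc 0) (Suc 0) = dm x" "lab (x, y, z) 2 2 = dm (x\<acute>)"
  "lab (x, y, z) 0 (Suc 0) = z" "lab (x, y, z) 0 2 = y" "lab (x, y, z) (Suc 0) 2 = x"
  "lab (x, y, z) (Suc 0) 0 = z\<acute>" "lab (x, y, z) 2 0 = y\<acute>" "lab (x, y, z) 2 (Suc 0) = x\<acute>"
  by (simp_all add: lab_def)

lemma lab_diag:
  assumes "s \<in> suitB A" "i < 3"
  shows "lab s i i \<preceq> \<e>"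
  using assms by (cases s) (auto simp: less_3_iff suitB_iff lab_eval dm idAt_leq)

lemma lab_cnv:
  assumes "s \<in> suitB A" "i < 3" "j < 3"
  shows "lab s j i = (lab s i j)\<acute>"
  using assms by (cases s) (auto simp: less_3_iff suitB_iff lab_eval dm cnv_idAt)

text \<open>Each diagonal label was defined from one chosen edge at the point; uniqueness of domains
  makes the choice immaterial, since all edges leaving a point have the same domain.\<close>

lemma lab_dm:
  assumes "s \<in> suitB A" "i < 3" "j < 3"
  shows "dm (lab s i j) = lab s i i"
proof -
  obtain x y z where s: "s = (x, y, z)" "x \<in> wa_At A" "y \<in> wa_At A" "z \<in> wa_At A" "y \<preceq> z \<odot> x"
    using assms(1) by (cases s) (simp add: suitB_iff)
  have "dm (dm u) = dm u" if "u \<in> wa_At A" for u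
    using dm[OF that] that by (intro dm_eqI leq_mul_one[of _ _ \<e>]) auto
  moreover have "dm y = dm z" "dm (y\<acute>) = dm (x\<acute>)" "dm x = dm (z\<acute>)"
    using dm_mul dm_mul_cnv s by blast+
  ultimately show ?thesis
    using assms(2,3) s by (auto simp: less_3_iff lab_eval)
qed

text \<open>For distinct indices these are the six forms of the one inequality in
  \<open>suitB\<close>. A repeated index leaves three cases: absorption of the domain, absorption of
  the range, and \<open>dm a \<preceq> a \<odot> a\<acute>\<close>.\<close>

lemma lab_triangle:
  assumes "s \<in> suitB A" "i < 3" "j < 3" "k < 3"
  shows "lab s i j \<preceq> lab s i k \<odot> lab s k j"
proof -
  obtain x y z where s: "s = (x, y, z)" "x \<in> wa_At A" "y \<in> wa_At A" "z \<in> wa_At A" "y \<preceq> z \<odot> x"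
    using assms(1) by (cases s) (simp add: suitB_iff)
  have dist: "i \<noteq> j \<Longrightarrow> i \<noteq> k \<Longrightarrow> j \<noteq> k \<Longrightarrow> ?thesis"
  proof -
    have 1: "x \<preceq> z\<acute> \<odot> y" "z \<preceq> y \<odot> x\<acute>" using triangle triangle' s by auto
    then have "y\<acute> \<preceq> x\<acute> \<odot> z\<acute>" "x\<acute> \<preceq> y\<acute> \<odot> z" "z\<acute> \<preceq> x \<odot> y\<acute>"
      using cnv_triangle[OF s(5)] cnv_triangle[OF 1(1)] cnv_triangle[OF 1(2)] s by auto
    then show "i \<noteq> j \<Longrightarrow> i \<noteq> k \<Longrightarrow> j \<noteq> k \<Longrightarrow> ?thesis"
      using 1 s assms(2-4) by (auto simp: less_3_iff lab_eval)
  qed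
  note At = lab_At[OF assms(1)]
  have "k = i \<Longrightarrow> ?thesis"
    using dm(2)[OF At, of i j] lab_dm[OF assms(1), of i j] assms by simp
  moreover have "k = j \<Longrightarrow> ?thesis"
    using mul_dm_cnv[OF At, of i j] lab_dm[OF assms(1), of j i] lab_cnv[OF assms(1), of i j] assms by simp
  moreover have "i = j \<Longrightarrow> ?thesis"
    using dm_leq_mul_cnv[OF At, of i k] lab_dm[OF assms(1), of i k] lab_cnv[OF assms(1), of i k] assms by simp
  ultimately show ?thesis using dist by blast
qed

lemma suitE_iff:
  assumes "s \<in> suitB A" "i < 3" "j < 3"
  shows "s \<in> suitE A i j \<longleftrightarrow> lab s i j \<preceq> \<e>"
proof (cases "i = j")
  case True
  then show ?thesis using assms lab_diag by (simp add: suitE_def)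
next
  case False
  then show ?thesis
    using assms cnv_leq_swap[of "tc s (3 - i - j)" \<e>] suitB_tc[of s "3 - i - j"]
    by (auto simp: suitE_def lab_def)
qed

lemma suitE_refl: "s \<in> suitB A \<Longrightarrow> s \<in> suitE A i i"
  by (simp add: suitE_def)

lemma suitE_sym: "s \<in> suitE A i j \<Longrightarrow> s \<in> suitE A j i"
  by (auto simp: suitE_def algebra_simps split: if_splits)

lemma suitE_lab:
  assumes "s \<in> suitE A i j" "i < 3" "j < 3" "k < 3"
  shows "lab s i k = lab s j k"
proof -
  have s: "s \<in> suitB A" using suitE_sub assms(1) .
  then show ?thesis
    using idAt_mul_left[OF lab_triangle[OF s, of i k j]] lab_At[OF s] assms suitE_iff[OF s] by simp
qed

lemma suitE_lab2:
  assumes "s \<in> suitE A i i'" "s \<in> suitE A j j'" "i < 3" "j < 3" "i' < 3" "j' < 3"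
  shows "lab s i j = lab s i' j'"
  using suitE_lab[OF assms(1), of j] suitE_lab[OF assms(2), of i']
    lab_cnv[OF suitE_sub[OF assms(1)], of j i'] lab_cnv[OF suitE_sub[OF assms(1)], of j' i'] assms
  by simp

lemma suitE_trans:
  assumes "s \<in> suitE A i j" "s \<in> suitE A j k" "i < 3" "j < 3" "k < 3"
  shows "s \<in> suitE A i k"
  using assms suitE_lab[OF assms(1), of k] suitE_iff[OF suitE_sub[OF assms(1)]] by simp

lemma suitT_lab:
  assumes T: "(s, t) \<in> suitT A l" "l < 3" and ij: "i < 3" "j < 3" "i \<noteq> l" "j \<noteq> l"
  shows "lab s i j = lab t i j"
proof -
  have s: "s \<in> suitB A" "t \<in> suitB A" "tc s l = tc t l" using T by (auto simp: suitT_iff)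
  have neq: "lab s i j = lab t i j" if "i < 3" "j < 3" "i \<noteq> l" "j \<noteq> l" "i \<noteq> j" for i j
  proof -
    have "3 - i - j = l" using that T(2) by (auto simp: less_3_iff)
    then show ?thesis using that s by (simp add: lab_def)
  qed
  show ?thesis
  proof (cases "i = j")
    case True
    \<comment> \<open>The edge from \<open>i\<close> to \<open>m\<close> is opposite to
      \<open>l\<close>, hence common to both triangles, and its domain is the diagonal label at
      \<open>i\<close>.\<close>
    obtain m :: nat where m: "m < 3" "m \<noteq> l" "m \<noteq> i"
      using ex_third by blast
    have "lab s i i = dm (lab s i m)" using lab_dm[of s i m] s(1) ij(1) m(1) by simp
    also have "lab s i m = lab t i m" using neq[of i m] ij m by blast
    also have "dm (lab t i m) = lab t i i" using lab_dm[of t i m] s(2) ij(1) m(1) by simp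
    finally show ?thesis using True by simp
  qed (use neq ij in blast)
qed

lemma suitT_suitE:
  assumes "(s, t) \<in> suitT A l" "l < 3" "i < 3" "j < 3" "i \<noteq> l" "j \<noteq> l"
  shows "s \<in> suitE A i j \<longleftrightarrow> t \<in> suitE A i j"
  using suitT_lab[OF assms] suitE_iff assms by (simp add: suitT_iff)

lemma lab_tc:
  assumes "lab s i j = lab t i j" "s \<in> suitB A" "t \<in> suitB A" "i < 3" "j < 3" "k < 3"
    "i \<noteq> j" "k \<noteq> i" "k \<noteq> j"
  shows "tc s k = tc t k"
proof -
  have "3 - i - j = k" using assms by (auto simp: less_3_iff)
  then show ?thesis
    using assms suitB_tc[of s k] suitB_tc[of t k] At_closed cnv_cnv
    by (metis lab_def)
qed

end

subsection \<open>Free reduction of trails\<close>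

text \<open>A trail \<open>rev r @ [(t, k)]\<close> is handled through the reversed prefix \<open>r\<close> and its last vertex \<open>t\<close>.\<close>

fun rtrail :: "('a, 'm) wa_alg_scheme \<Rightarrow> 'a trail \<Rightarrow> 'a \<times> 'a \<times> 'a \<Rightarrow> bool" where
  "rtrail A [] t \<longleftrightarrow> t \<in> suitB A"
| "rtrail A ((x, k) # r) t \<longleftrightarrow> k < 3 \<and> x \<noteq> t \<and> (x, t) \<in> suitT A k \<and> rtrail A r x"

lemma is_trail_successively:
  "is_trail A p \<longleftrightarrow> p \<noteq> [] \<and> (\<forall>u\<in>set p. fst u \<in> suitB A \<and> snd u < 3) \<and>
    successively (\<lambda>u v. fst u \<noteq> fst v \<and> (fst u, fst v) \<in> suitT A (snd u)) p"
  unfolding is_trail_def successively_conv_nth by (auto simp: all_set_conv_all_nth)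

lemma rtrail_suitB: "rtrail A r t \<Longrightarrow> t \<in> suitB A"
  by (cases r) (auto simp: suitT_iff)

lemma is_trail_snoc: "is_trail A (rev r @ [(t, k)]) \<longleftrightarrow> k < 3 \<and> rtrail A r t"
proof (induction r arbitrary: t k)
  case Nil
  then show ?case by (auto simp: is_trail_successively)
next
  case (Cons u r)
  obtain x j where u: "u = (x, j)" by (cases u)
  have "is_trail A (rev (u # r) @ [(t, k)]) \<longleftrightarrow>
      is_trail A (rev r @ [(x, j)]) \<and> k < 3 \<and> x \<noteq> t \<and> (x, t) \<in> suitT A j"
    by (auto simp: is_trail_successively successively_append_iff u suitT_iff)
  then show ?case using Cons.IH u by auto
qed

lemma is_trail_Cons:
  "w \<noteq> [] \<Longrightarrow> is_trail A ((t, k) # w) \<longleftrightarrow>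
    k < 3 \<and> t \<noteq> fst (hd w) \<and> (t, fst (hd w)) \<in> suitT A k \<and> is_trail A w"
  by (cases w) (auto simp: is_trail_successively suitT_iff)

lemma Trl_snoc_iff: "rev r @ [(t, k)] \<in> Trl A \<longleftrightarrow> k < 3 \<and> rtrail A r t"
  by (simp add: Trl_def is_trail_snoc)

lemma Trl_cases:
  assumes "p \<in> Trl A"
  obtains r t k where "p = rev r @ [(t, k)]" "k < 3" "rtrail A r t"
proof -
  have "p \<noteq> []" using assms by (simp add: Trl_def is_trail_def)
  then obtain p' t k where "p = p' @ [(t, k)]"
    by (metis append_butlast_last_id surj_pair)
  then have "p = rev (rev p') @ [(t, k)]" by simp
  then show thesis using that assms Trl_snoc_iff by metis
qed

lemma Trl_nonempty: "p \<in> Trl A \<Longrightarrow> p \<noteq> []"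
  by (simp add: Trl_def is_trail_def)

lemma rtrail_append: "rtrail A (w @ (t, k) # r) x \<Longrightarrow> rtrail A r t"
  by (induction w arbitrary: x) auto

text \<open>One move from \<open>x\<close> to \<open>s\<close> along label \<open>k\<close>,
  updating the path already reduced: each entry holds the vertex left and the label used, and the
  move pops exactly when it undoes the last one.\<close>

definition push :: "'v \<Rightarrow> 'k \<Rightarrow> 'v \<Rightarrow> ('v \<times> 'k) list \<Rightarrow> ('v \<times> 'k) list" where
  "push x k s \<rho> = (if \<rho> \<noteq> [] \<and> hd \<rho> = (s, k) then tl \<rho> else (x, k) # \<rho>)"

fun stack :: "('v \<times> 'k) list \<Rightarrow> 'v \<Rightarrow> ('v \<times> 'k) list" where
  "stack [] t = []"
| "stack ((x, k) # r) t = push x k t (stack r x)"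

fun reduced :: "('a, 'm) wa_alg_scheme \<Rightarrow> 'a \<times> 'a \<times> 'a \<Rightarrow> 'a trail \<Rightarrow> bool" where
  "reduced A x [] \<longleftrightarrow> x \<in> suitB A"
| "reduced A x ((y, l) # \<rho>) \<longleftrightarrow> l < 3 \<and> y \<noteq> x \<and> (y, x) \<in> suitT A l \<and> reduced A y \<rho> \<and>
     (\<rho> \<noteq> [] \<longrightarrow> hd \<rho> \<noteq> (x, l))"

lemma reduced_suitB: "reduced A x \<rho> \<Longrightarrow> x \<in> suitB A"
  by (cases \<rho>) (auto simp: suitT_iff)

lemma reduced_push:
  assumes "reduced A x \<rho>" "x \<noteq> s" "(x, s) \<in> suitT A k" "k < 3"
  shows "reduced A s (push x k s \<rho>)"
  using assms by (cases \<rho>) (auto simp: push_def)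

text \<open>If the first move pops \<open>(s, k)\<close>, reducedness forbids \<open>(x, k)\<close>
  as the next entry, so the second move cannot pop as well and restores what was removed.\<close>

lemma push_push:
  assumes "reduced A x \<rho>"
  shows "push s k x (push x k s \<rho>) = \<rho>"
proof (cases \<rho>)
  case (Cons u \<rho>')
  then show ?thesis
    using assms by (cases u) (auto simp: push_def)
qed (simp add: push_def)

lemma reduced_stack: "rtrail A r t \<Longrightarrow> reduced A t (stack r t)"
proof (induction r arbitrary: t)
  case (Cons u r)
  then show ?case by (cases u) (simp add: reduced_push)
qed simp

lemma stack_cong:
  "stack r t = stack r' t \<Longrightarrow> stack (w @ (t, k) # r) x = stack (w @ (t, k) # r') x"
  by (induction w arbitrary: x) auto

section \<open>Normal forms of points\<close>

context atomic_weakly_associative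
begin

text \<open>The normal form of point \<open>i\<close> of the triangle \<open>x\<close> reached by the reduced trail \<open>\<rho>\<close>: walk back
  along \<open>\<rho>\<close> as long as the point, possibly under another index, is shared with the previous triangle.
  Traversing an edge with label \<open>l\<close> moves point \<open>l\<close> only.\<close>

definition shared :: "'a \<times> 'a \<times> 'a \<Rightarrow> nat \<Rightarrow> nat \<Rightarrow> nat \<Rightarrow> bool" where
  "shared x l i j \<longleftrightarrow> j < 3 \<and> j \<noteq> l \<and> x \<in> suitE A i j"

fun canon :: "'a \<times> 'a \<times> 'a \<Rightarrow> 'a trail \<Rightarrow> nat \<Rightarrow> ('a \<times> 'a \<times> 'a) \<times> 'a trail \<times> nat" where
  "canon x [] i = (x, [], LEAST j. j < 3 \<and> x \<in> suitE A i j)"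
| "canon x ((y, l) # \<rho>) i =
    (if \<exists>j. shared x l i j then canon y \<rho> (SOME j. shared x l i j) else (x, (y, l) # \<rho>, i))"

lemmas canon_Cons = canon.simps(2)
declare canon_Cons [simp del]

lemma canon_new: "\<nexists>j. shared x l i j \<Longrightarrow> canon x ((y, l) # \<rho>) i = (x, (y, l) # \<rho>, i)"
  unfolding canon_Cons by (rule if_not_P)

lemma canon_old: "\<exists>j. shared x l i j \<Longrightarrow> canon x ((y, l) # \<rho>) i = canon y \<rho> (SOME j. shared x l i j)"
  unfolding canon_Cons by (rule if_P)

text \<open>Identified indices have the same candidates, hence the same value of \<open>SOME\<close>
  or \<open>LEAST\<close>. If there is no candidate, both indices must equal
  \<open>l\<close>.\<close>

lemma canon_suitE:
  assumes "i < 3" "j < 3" "x \<in> suitE A i j"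
  shows "canon x \<rho> i = canon x \<rho> j"
proof -
  have x: "x \<in> suitB A" using assms suitE_sub by blast
  have eq: "k < 3 \<and> x \<in> suitE A i k \<longleftrightarrow> k < 3 \<and> x \<in> suitE A j k" for k
    using assms suitE_trans suitE_sym by blast
  show ?thesis
  proof (cases \<rho>)
    case Nil
    then show ?thesis by (simp add: eq)
  next
    case (Cons u \<rho>')
    obtain y l where u: "u = (y, l)" by (cases u)
    have P: "shared x l i = shared x l j"
      using eq unfolding shared_def by blast
    show ?thesis
    proof (cases "\<exists>k. shared x l i k")
      case True
      then show ?thesis unfolding Cons u P using canon_old P by metis
    next
      case False
      then have "i = j"
        using assms suitE_refl[OF x] unfolding shared_def by blast
      then show ?thesis by simp
    qed
  qed
qed

text \<open>Replaces the arbitrary choice in \<open>canon\<close> by any candidate. All candidates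
  are identified in \<open>x\<close>, and being different from \<open>l\<close> they are identified
  in \<open>y\<close> too, so the normal forms from \<open>y\<close> agree.\<close>

lemma canon_descend:
  assumes r: "reduced A x ((y, l) # \<rho>)" and ij: "i < 3" "j < 3" "j \<noteq> l" "x \<in> suitE A i j"
  shows "canon x ((y, l) # \<rho>) i = canon y \<rho> j"
proof -
  have j: "shared x l i j" using ij by (simp add: shared_def)
  then have "shared x l i (SOME j. shared x l i j)" by (rule someI)
  moreover have "canon y \<rho> m = canon y \<rho> j" if "shared x l i m" for m
  proof -
    have that: "m < 3" "m \<noteq> l" "x \<in> suitE A i m" using that by (simp_all add: shared_def)
    have "x \<in> suitE A m j" using that ij suitE_trans suitE_sym by blast
    then have "y \<in> suitE A m j"
      using suitT_suitE[of y x l m j] that ij r by auto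
    then show ?thesis using canon_suitE that ij by blast
  qed
  ultimately show ?thesis using j canon_old by metis
qed

lemma canon_length: "length (fst (snd (canon x \<rho> i))) \<le> length \<rho>"
proof (induction \<rho> arbitrary: x i)
  case (Cons u \<rho>)
  obtain y l where u: "u = (y, l)" by (cases u)
  show ?case
  proof (cases "\<exists>j. shared x l i j")
    case True
    show ?thesis using le_SucI[OF Cons.IH] unfolding u canon_old[OF True] by simp
  next
    case False
    show ?thesis unfolding u canon_new[OF False] by simp
  qed
qed simp

lemma canon_full:
  assumes "length (fst (snd (canon x \<rho> i))) = length \<rho>"
  shows "fst (canon x \<rho> i) = x \<and> fst (snd (canon x \<rho> i)) = \<rho>"
proof (cases \<rho>)
  case (Cons u \<rho>')
  obtain y l where u: "u = (y, l)" by (cases u)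
  show ?thesis
  proof (cases "\<exists>j. shared x l i j")
    case True
    show ?thesis
      using assms canon_length[of y \<rho>' "SOME j. shared x l i j"] unfolding Cons u canon_old[OF True]
      by simp
  next
    case False
    show ?thesis unfolding Cons u canon_new[OF False] by simp
  qed
qed simp

text \<open>Descending points are handled by induction, since identification of indices other than
  \<open>l\<close> passes from \<open>y\<close> back to \<open>x\<close>. A point that stays keeps
  the whole path and so cannot agree with one that descends, and only index \<open>l\<close> can
  stay.\<close>

lemma canon_eq_suitE:
  assumes "reduced A x \<rho>" "i < 3" "j < 3" "canon x \<rho> i = canon x \<rho> j"
  shows "x \<in> suitE A i j"
  using assms
proof (induction \<rho> arbitrary: x i j)
  case Nil
  have least: "x \<in> suitE A k (LEAST m. m < 3 \<and> x \<in> suitE A k m) \<and> (LEAST m. m < 3 \<and> x \<in> suitE A k m) < 3"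
    if "k < 3" for k
  proof -
    have "k < 3 \<and> x \<in> suitE A k k" using that Nil suitE_refl by simp
    from LeastI[of "\<lambda>m. m < 3 \<and> x \<in> suitE A k m", OF this] show ?thesis by blast
  qed
  have "(LEAST m. m < 3 \<and> x \<in> suitE A i m) = (LEAST m. m < 3 \<and> x \<in> suitE A j m)"
    using Nil by simp
  then obtain m where "m < 3" "x \<in> suitE A i m" "x \<in> suitE A j m"
    using least[OF Nil(2)] least[OF Nil(3)] by metis
  then show ?case
    using Nil suitE_sym suitE_trans by blast
next
  case (Cons u \<rho>)
  obtain y l where u: "u = (y, l)" by (cases u)
  have x: "x \<in> suitB A" using Cons reduced_suitB by blast
  let ?P = "shared x l"
  have stay: "canon x (u # \<rho>) k = (x, u # \<rho>, k) \<and> k = l" if "\<nexists>m. ?P k m" "k < 3" for k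
  proof -
    have "\<not> ?P k k" using that by blast
    then have "k = l" using that(2) suitE_refl[OF x] unfolding shared_def by blast
    then show ?thesis using canon_new[OF that(1)] u by simp
  qed
  have desc: "canon x (u # \<rho>) k = canon y \<rho> m" if "?P k m" "k < 3" for k m
    using that canon_descend u Cons.prems unfolding shared_def by blast
  have short: "canon x (u # \<rho>) k \<noteq> (x, u # \<rho>, k')" if "?P k m" "k < 3" for k k' m
    using canon_length[of y \<rho> m] desc[OF that] by auto
  show ?case
  proof (cases "(\<exists>m. ?P i m) \<and> (\<exists>m. ?P j m)")
    case True
    then obtain m n where mn: "?P i m" "?P j n" by blast
    then have "m < 3" "n < 3" by (simp_all add: shared_def)
    moreover have "canon y \<rho> m = canon y \<rho> n"
      using desc[of i m] desc[of j n] mn Cons.prems by simp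
    ultimately have "y \<in> suitE A m n"
      using Cons.IH Cons.prems(1) u by simp
    then have "x \<in> suitE A m n"
      using suitT_suitE[of y x l m n] mn Cons.prems u by (simp add: shared_def)
    then show ?thesis
      using mn Cons.prems suitE_sym suitE_trans unfolding shared_def by blast
  next
    case False
    then have "\<not> (\<exists>m. ?P i m) \<and> \<not> (\<exists>m. ?P j m)"
      using stay short Cons.prems by metis
    then show ?thesis
      using stay suitE_refl[OF x] Cons.prems by metis
  qed
qed

text \<open>The recursion scheme for pairs of points: either both are shared with the preceding
  triangle, and so is their label, or one of them is new and its normal form records the entire
  path.\<close>

lemma canon_cases:
  assumes r: "reduced A x \<rho>" and ij: "i < 3" "j < 3"
  obtains (old) y l \<rho>' i' j' where "\<rho> = (y, l) # \<rho>'" "reduced A y \<rho>'" "i' < 3" "j' < 3"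
      "canon x \<rho> i = canon y \<rho>' i'" "canon x \<rho> j = canon y \<rho>' j'" "lab x i j = lab y i' j'"
  | (new) k where "k \<in> {i, j}" "fst (canon x \<rho> k) = x" "fst (snd (canon x \<rho> k)) = \<rho>"
proof (cases \<rho>)
  case Nil
  then show thesis using new[of i] by simp
next
  case (Cons u \<rho>')
  obtain y l where u: "u = (y, l)" by (cases u)
  show thesis
  proof (cases "(\<exists>i'. shared x l i i') \<and> (\<exists>j'. shared x l j j')")
    case True
    then obtain i' j' where *: "i' < 3" "i' \<noteq> l" "x \<in> suitE A i i'" "j' < 3" "j' \<noteq> l" "x \<in> suitE A j j'"
      unfolding shared_def by blast
    have "lab x i j = lab y i' j'"
      using suitE_lab2[OF *(3,6)] suitT_lab[of y x l i' j'] * ij r Cons u by simp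
    moreover have "canon x \<rho> i = canon y \<rho>' i'" "canon x \<rho> j = canon y \<rho>' j'"
      using canon_descend[of x y l \<rho>'] * ij r Cons u by blast+
    moreover have "reduced A y \<rho>'" using r Cons u by simp
    ultimately show thesis using old[of y l \<rho>' i' j'] * Cons u by blast
  next
    case False
    then obtain k where k: "k \<in> {i, j}" "\<nexists>m. shared x l k m" by blast
    then have "canon x \<rho> k = (x, \<rho>, k)" using canon_new Cons u by blast
    then show thesis using new[of k] k by simp
  qed
qed

text \<open>Descend on whichever side has both points old. If each side has a new point, each path
  is at most as long as the other, so the normal forms record the same triangle and path; the
  indices then agree up to \<open>suitE\<close>.\<close>

lemma canon_eq_lab:
  assumes "reduced A x \<rho>" "reduced A x' \<rho>'" "i < 3" "j < 3" "i' < 3" "j' < 3"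
    "canon x \<rho> i = canon x' \<rho>' i'" "canon x \<rho> j = canon x' \<rho>' j'"
  shows "lab x i j = lab x' i' j'"
  using assms
proof (induction "length \<rho> + length \<rho>'" arbitrary: x x' \<rho> \<rho>' i j i' j' rule: less_induct)
  case less
  from less.prems(1,3,4) show ?case
  proof (cases rule: canon_cases)
    case (old y l \<sigma> m n)
    then have "lab y m n = lab x' i' j'"
      using less.prems by (intro less.hyps[of \<sigma> \<rho>']) auto
    then show ?thesis using old by simp
  next
    case k: (new k)
    from less.prems(2,5,6) show ?thesis
    proof (cases rule: canon_cases)
      case (old y l \<sigma> m n)
      then have "lab x i j = lab y m n"
        using less.prems by (intro less.hyps[of \<rho> \<sigma>]) auto
      then show ?thesis using old by simp
    next
      case k': (new k')
      have "length \<rho> \<le> length \<rho>'"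
        using k less.prems canon_length[of x' \<rho>'] by (metis empty_iff insert_iff)
      moreover have "length \<rho>' \<le> length \<rho>"
        using k' less.prems canon_length[of x \<rho>] by (metis empty_iff insert_iff)
      ultimately have "x = x' \<and> \<rho> = \<rho>'"
        using k less.prems canon_full[of x' \<rho>' i'] canon_full[of x' \<rho>' j'] by auto
      then show ?thesis
        using suitE_lab2 canon_eq_suitE less.prems by metis
    qed
  qed
qed

definition node :: "'a trail \<Rightarrow> ('a \<times> 'a \<times> 'a) \<times> 'a trail \<times> nat" where
  "node p = canon (fst (last p)) (stack (tl (rev p)) (fst (last p))) (snd (last p))"

lemma node_snoc: "node (rev r @ [(t, k)]) = canon t (stack r t) k"
  by (simp add: node_def)

text \<open>A move along \<open>l\<close> fixes point \<open>n\<close>. If it lengthens the path,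
  this is a descent from \<open>s\<close> to \<open>t\<close>; if it cancels, it is the descent from
  \<open>t\<close> to \<open>s\<close> read backwards.\<close>

lemma canon_push:
  assumes "reduced A t \<rho>" "t \<noteq> s" "(t, s) \<in> suitT A l" "l < 3" "n < 3" "n \<noteq> l"
  shows "canon s (push t l s \<rho>) n = canon t \<rho> n"
proof (cases "\<rho> \<noteq> [] \<and> hd \<rho> = (s, l)")
  case True
  then have "\<rho> = (s, l) # push t l s \<rho>" by (cases \<rho>) (auto simp: push_def)
  then show ?thesis
    using canon_descend[of t s l "push t l s \<rho>" n n] assms suitE_refl reduced_suitB by metis
next
  case False
  then have "push t l s \<rho> = (t, l) # \<rho>" by (auto simp: push_def)
  moreover have "s \<in> suitB A" using assms by (simp add: suitT_iff)
  ultimately show ?thesis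
    using canon_descend[of s t l \<rho> n n] reduced_push[OF assms(1-4)] assms suitE_refl by metis
qed

lemma node_step:
  assumes "trail_step A p q"
  shows "node p = node q"
proof -
  have pq: "p \<in> Trl A" "q \<in> Trl A" using assms by (auto simp: trail_step_def)
  from assms consider
    (a) pre suf t l s k where "p = pre @ [(t, l), (s, l), (t, k)] @ suf" "q = pre @ [(t, k)] @ suf"
  | (b) pre t l s n where "l \<noteq> n" "p = pre @ [(t, l), (s, n)]" "q = pre @ [(t, n)]"
  | (c) pre t l k where "t \<in> suitE A l k" "p = pre @ [(t, l)]" "q = pre @ [(t, k)]"
    unfolding trail_step_def by blast
  then show ?thesis
  proof cases
    case a
    have stack: "stack ((s, l) # (t, l) # rev pre) t = stack (rev pre) t" if "rtrail A (rev pre) t"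
      using push_push[OF reduced_stack[OF that]] by simp
    show ?thesis
    \<comment> \<open>The last pair of a trail supplies triangle and index while the rest feeds the
      stack, so a backtrack just before the end is separated from one further inside, where
      \<open>stack_cong\<close> carries the equality along.\<close>
    proof (cases suf rule: rev_cases)
      case Nil
      have "p = rev ((s, l) # (t, l) # rev pre) @ [(t, k)]" "q = rev (rev pre) @ [(t, k)]"
        using a Nil by simp_all
      moreover from this have "rtrail A (rev pre) t" using pq Trl_snoc_iff by metis
      ultimately show ?thesis using stack node_snoc by metis
    next
      case (snoc w u)
      obtain x j where u: "u = (x, j)" by (cases u)
      have "p = rev (rev w @ (t, k) # (s, l) # (t, l) # rev pre) @ [(x, j)]"
        "q = rev (rev w @ (t, k) # rev pre) @ [(x, j)]"
        using a snoc u by simp_all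
      moreover from this have "rtrail A (rev pre) t" using pq Trl_snoc_iff rtrail_append by metis
      ultimately show ?thesis using stack_cong[OF stack] node_snoc by metis
    qed
  next
    case b
    have eq: "p = rev ((t, l) # rev pre) @ [(s, n)]" "q = rev (rev pre) @ [(t, n)]"
      using b by simp_all
    then have "rtrail A ((t, l) # rev pre) s" "n < 3" using pq Trl_snoc_iff by metis+
    then show ?thesis
      unfolding eq node_snoc using canon_push[OF reduced_stack] b by simp
  next
    case c
    have eq: "p = rev (rev pre) @ [(t, l)]" "q = rev (rev pre) @ [(t, k)]"
      using c by simp_all
    then have "l < 3" "k < 3" using pq Trl_snoc_iff by metis+
    then show ?thesis
      unfolding eq node_snoc using canon_suitE c by simp
  qed
qed

lemma node_eq: "trail_eq A p q \<Longrightarrow> node p = node q"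
  by (induction rule: trail_eq.induct) (auto simp: node_step)

end

section \<open>Equality of points in terms of the suitable structure\<close>

lemma trail_eq_Trl: "trail_eq A p q \<Longrightarrow> p \<in> Trl A \<and> q \<in> Trl A"
  by (induction rule: trail_eq.induct) (auto simp: trail_step_def)

lemma trail_eq_backtrack:
  assumes "pre @ (t, l) # (s, l) # (t, k) # suf \<in> Trl A" "pre @ (t, k) # suf \<in> Trl A"
  shows "trail_eq A (pre @ (t, l) # (s, l) # (t, k) # suf) (pre @ (t, k) # suf)"
proof (rule teq_step, unfold trail_step_def, intro conjI disjI1 exI)
  show "pre @ (t, l) # (s, l) # (t, k) # suf = pre @ [(t, l), (s, l), (t, k)] @ suf" by simp
qed (use assms in simp_all)

lemma trail_eq_move:
  assumes "l \<noteq> n" "pre @ [(t, l), (s, n)] \<in> Trl A" "pre @ [(t, n)] \<in> Trl A"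
  shows "trail_eq A (pre @ [(t, l), (s, n)]) (pre @ [(t, n)])"
  by (rule teq_step, unfold trail_step_def, intro conjI disjI2 disjI1 exI) (use assms in simp_all)

lemma trail_eq_relabel:
  assumes "t \<in> suitE A l k" "pre @ [(t, l)] \<in> Trl A" "pre @ [(t, k)] \<in> Trl A"
  shows "trail_eq A (pre @ [(t, l)]) (pre @ [(t, k)])"
  by (rule teq_step, unfold trail_step_def, intro conjI disjI2 exI) (use assms in simp_all)

lemma trail_cls_eq_iff: "p \<in> Trl A \<Longrightarrow> trail_cls A p = trail_cls A q \<longleftrightarrow> trail_eq A p q"
  unfolding trail_cls_def by (blast intro: trail_eq.intros)

lemma tr_upd_snoc [simp]: "tr_upd (w @ [(t, k)]) l = w @ [(t, l)]"
  by (simp add: tr_upd_def)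

lemma tr_upd_Trl: "p \<in> Trl A \<Longrightarrow> l < 3 \<Longrightarrow> tr_upd p l \<in> Trl A"
  by (elim Trl_cases) (simp add: Trl_snoc_iff)

context atomic_weakly_associative
begin

lemma tr_upd_eq_lab:
  assumes p: "p \<in> Trl A" "q \<in> Trl A" and ij: "i < 3" "j < 3" "i' < 3" "j' < 3"
    and eq: "trail_eq A (tr_upd p i) (tr_upd q i')" "trail_eq A (tr_upd p j) (tr_upd q j')"
  shows "lab (fst (last p)) i j = lab (fst (last q)) i' j'"
proof -
  obtain r t k where r: "p = rev r @ [(t, k)]" "rtrail A r t" using p Trl_cases by metis
  obtain r' t' k' where r': "q = rev r' @ [(t', k')]" "rtrail A r' t'" using p Trl_cases by metis
  show ?thesis
    using canon_eq_lab[OF reduced_stack reduced_stack, OF r(2) r'(2) ij]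
      node_eq[OF eq(1)] node_eq[OF eq(2)] by (simp add: r(1) r'(1) node_snoc)
qed

lemma tr_upd_eq_suitE:
  assumes p: "p \<in> Trl A" and ij: "i < 3" "j < 3"
  shows "trail_eq A (tr_upd p i) (tr_upd p j) \<longleftrightarrow> fst (last p) \<in> suitE A i j"
proof -
  obtain r t k where r: "p = rev r @ [(t, k)]" "rtrail A r t" using p Trl_cases by metis
  show ?thesis
  proof
    assume "trail_eq A (tr_upd p i) (tr_upd p j)"
    then show "fst (last p) \<in> suitE A i j"
      using canon_eq_suitE[OF reduced_stack[OF r(2)] ij] node_eq[of "tr_upd p i" "tr_upd p j"]
      by (simp add: r(1) node_snoc)
  next
    assume "fst (last p) \<in> suitE A i j"
    then show "trail_eq A (tr_upd p i) (tr_upd p j)"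
      using trail_eq_relabel[of t A i j "rev r"] tr_upd_Trl[OF p ij(1)] tr_upd_Trl[OF p ij(2)] r(1)
      by simp
  qed
qed

lemma tr_upd_eq_suitT:
  assumes p: "p \<in> Trl A" "q \<in> Trl A" and k: "k < 3"
    and eq: "\<And>l. l < 3 \<Longrightarrow> l \<noteq> k \<Longrightarrow> trail_eq A (tr_upd p l) (tr_upd q l)"
  shows "(fst (last p), fst (last q)) \<in> suitT A k"
proof -
  have B: "fst (last p) \<in> suitB A" "fst (last q) \<in> suitB A"
    using p by (auto elim!: Trl_cases dest: rtrail_suitB)
  \<comment> \<open>The two remaining indices: component \<open>k\<close> labels the edge between
    these two shared points.\<close>
  obtain i :: nat where i: "i < 3" "i \<noteq> k" using ex_third by blast
  obtain j :: nat where j: "j < 3" "j \<noteq> i" "j \<noteq> k" using ex_third by blast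
  have "tc (fst (last p)) k = tc (fst (last q)) k"
    using tr_upd_eq_lab[OF p, of i j i j] eq i j k B by (intro lab_tc[of _ i j]) auto
  then show ?thesis using B by (simp add: suitT_iff)
qed

end

subsection \<open>Automorphisms by left translation\<close>

lemma trail_step_start: "trail_step A p q \<Longrightarrow> fst (hd p) = fst (hd q)"
  by (auto simp: trail_step_def hd_append)

lemma trail_eq_start: "trail_eq A p q \<Longrightarrow> fst (hd p) = fst (hd q)"
  by (induction rule: trail_eq.induct) (auto dest: trail_step_start)

lemma trail_step_append:
  assumes "trail_step A p q" "c @ p \<in> Trl A" "c @ q \<in> Trl A"
  shows "trail_step A (c @ p) (c @ q)"
proof -
  from assms(1) consider
    (a) pre suf t l s k where "p = pre @ [(t, l), (s, l), (t, k)] @ suf" "q = pre @ [(t, k)] @ suf"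
  | (b) pre t l s n where "l \<noteq> n" "p = pre @ [(t, l), (s, n)]" "q = pre @ [(t, n)]"
  | (c) pre t l k where "t \<in> suitE A l k" "p = pre @ [(t, l)]" "q = pre @ [(t, k)]"
    unfolding trail_step_def by blast
  then show ?thesis
  proof cases
    case a
    show ?thesis
      by (unfold trail_step_def, intro conjI disjI1 exI[of _ "c @ pre"] exI) (use a assms(2,3) in simp_all)
  next
    case b
    show ?thesis
      by (unfold trail_step_def, intro conjI disjI2 disjI1 exI[of _ "c @ pre"] exI)
        (use b assms(2,3) in simp_all)
  next
    case c
    show ?thesis
      by (unfold trail_step_def, intro conjI disjI2 exI[of _ "c @ pre"] exI) (use c assms(2,3) in simp_all)
  qed
qed

text \<open>Stated through the effect of the prefix on trails, so that the empty prefix, which has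
  no first vertex of its own, counts as the identity translation.\<close>

definition moves :: "('a, 'm) wa_alg_scheme \<Rightarrow> 'a trail \<Rightarrow> 'a \<times> 'a \<times> 'a \<Rightarrow> 'a \<times> 'a \<times> 'a \<Rightarrow> bool" where
  "moves A c b a \<longleftrightarrow> (\<forall>w\<in>Trl A. fst (hd w) = a \<longrightarrow> c @ w \<in> Trl A \<and> fst (hd (c @ w)) = b)"

lemma moves_trail_eq:
  assumes c: "moves A c b a"
  shows "trail_eq A p q \<Longrightarrow> fst (hd p) = a \<Longrightarrow> trail_eq A (c @ p) (c @ q)"
proof (induction rule: trail_eq.induct)
  case (teq_refl p)
  then show ?case using c trail_eq.teq_refl unfolding moves_def by blast
next
  case (teq_step p q)
  then have "p \<in> Trl A" "q \<in> Trl A" "fst (hd q) = a"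
    using trail_step_start[OF teq_step(1)] by (auto simp: trail_step_def)
  then show ?case
    using trail_step_append[OF teq_step(1)] c teq_step trail_eq.teq_step unfolding moves_def by metis
next
  case (teq_sym p q)
  then show ?case using trail_eq_start[OF teq_sym(1)] trail_eq.teq_sym by metis
next
  case (teq_trans p q r)
  then show ?case using trail_eq_start[OF teq_trans(1)] trail_eq.teq_trans by metis
qed

definition transport ::
  "('a, 'm) wa_alg_scheme \<Rightarrow> 'a trail \<Rightarrow> 'a trail \<Rightarrow> 'a \<times> 'a \<times> 'a \<Rightarrow> 'a \<times> 'a \<times> 'a \<Rightarrow> bool" where
  "transport A c d b a \<longleftrightarrow> moves A c b a \<and> moves A d a b \<and>
    (\<forall>w\<in>Trl A. fst (hd w) = a \<longrightarrow> trail_eq A (d @ c @ w) w) \<and>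
    (\<forall>w\<in>Trl A. fst (hd w) = b \<longrightarrow> trail_eq A (c @ d @ w) w)"

lemma transport_sym: "transport A c d b a \<Longrightarrow> transport A d c a b"
  by (auto simp: transport_def)

lemma transport_refl: "transport A [] [] a a"
  by (simp add: transport_def moves_def teq_refl)

lemma moves_append: "moves A c b a \<Longrightarrow> moves A c' a a' \<Longrightarrow> moves A (c @ c') b a'"
  by (simp add: moves_def)

lemma transport_trans:
  assumes 1: "transport A c d b a" and 2: "transport A c' d' a a'"
  shows "transport A (c @ c') (d' @ d) b a'"
proof -
  \<comment> \<open>The inner pair cancels in front of \<open>f' @ w\<close>, then the outer pair.
    Arbitrary names allow a second use with both transports reversed, giving the other
    composite.\<close>
  have "trail_eq A (f @ e @ e' @ f' @ w) w"
    if e: "transport A e e' x y" and f: "transport A f f' z x" and w: "w \<in> Trl A" "fst (hd w) = z"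
    for e e' f f' x y z w
  proof -
    have w': "f' @ w \<in> Trl A" "fst (hd (f' @ w)) = x"
      using f w unfolding transport_def moves_def by blast+
    then have "trail_eq A (e @ e' @ f' @ w) (f' @ w)" "fst (hd (e @ e' @ f' @ w)) = x"
      using e unfolding transport_def moves_def by metis+
    then have "trail_eq A (f @ e @ e' @ f' @ w) (f @ f' @ w)"
      using f moves_trail_eq unfolding transport_def by blast
    moreover have "trail_eq A (f @ f' @ w) w"
      using f w unfolding transport_def by blast
    ultimately show ?thesis by (rule teq_trans)
  qed
  note cancel = this
  show ?thesis
    unfolding transport_def append_assoc
    using 1 2 moves_append cancel[OF 2 1] cancel[OF transport_sym[OF 1] transport_sym[OF 2]]
    unfolding transport_def by blast
qed

lemma transport_edge:
  assumes T: "x \<noteq> t" "(x, t) \<in> suitT A k" "k < 3"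
  shows "transport A [(x, k)] [(t, k)] x t"
proof -
  have T': "t \<noteq> x" "(t, x) \<in> suitT A k" using T by (auto simp: suitT_iff)
  have mv: "moves A [(u, k)] u v" if "u \<noteq> v" "(u, v) \<in> suitT A k" for u v
    unfolding moves_def
  proof (intro ballI impI)
    fix w assume w: "w \<in> Trl A" "fst (hd w) = v"
    then show "[(u, k)] @ w \<in> Trl A \<and> fst (hd ([(u, k)] @ w)) = u"
      using that T(3) is_trail_Cons[of w A u k] Trl_nonempty[OF w(1)] by (simp add: Trl_def)
  qed
  have "trail_eq A ([(v, k)] @ [(u, k)] @ w) w"
    if "u \<noteq> v" "(u, v) \<in> suitT A k" "w \<in> Trl A" "fst (hd w) = v" for u v w
  proof -
    have w: "w = (v, snd (hd w)) # tl w"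
      using Trl_nonempty[OF that(3)] that(4) by (metis list.collapse prod.collapse)
    have "moves A [(u, k)] u v" "moves A [(v, k)] v u"
      using mv[of u v] mv[of v u] that by (auto simp: suitT_iff)
    then have "[(v, k)] @ [(u, k)] @ w \<in> Trl A"
      using that unfolding moves_def by blast
    then show ?thesis
      using trail_eq_backtrack[of "[]" v k u "snd (hd w)" "tl w" A] that(3) w by simp
  qed
  then show ?thesis
    unfolding transport_def using mv T T' by blast
qed

text \<open>Composes one-edge translations; the inverse prefix walks the edges back. The final pair
  \<open>(t, k)\<close> gives the expression a start vertex even when \<open>r\<close> is
  empty.\<close>

lemma rtrail_transport:
  assumes "rtrail A r t"
  shows "\<exists>d. transport A (rev r) d (fst (hd (rev r @ [(t, k)]))) t"
  using assms
proof (induction r arbitrary: t k)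
  case Nil
  show ?case using transport_refl[of A t] by auto
next
  case (Cons u r)
  obtain x j where u: "u = (x, j)" by (cases u)
  obtain d where "transport A (rev r) d (fst (hd (rev r @ [(x, j)]))) x"
    using Cons u by fastforce
  then have "transport A (rev r @ [(x, j)]) ([(t, j)] @ d) (fst (hd (rev r @ [(x, j)]))) t"
    using transport_edge[of x t A j] Cons.prems u by (intro transport_trans) auto
  then show ?case using u by (auto simp: hd_append)
qed

text \<open>Two trails ending at the same triangle may start at different vertices \<open>a\<close> and \<open>b\<close>; the
  translation then exchanges the trails from \<open>a\<close> with those from \<open>b\<close>.\<close>

definition swap ::
  "'a trail \<Rightarrow> 'a trail \<Rightarrow> 'a \<times> 'a \<times> 'a \<Rightarrow> 'a \<times> 'a \<times> 'a \<Rightarrow> 'a trail \<Rightarrow> 'a trail" where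
  "swap c d b a w = (if fst (hd w) = a then c @ w else if fst (hd w) = b then d @ w else w)"

lemma swap_Trl: "transport A c d b a \<Longrightarrow> w \<in> Trl A \<Longrightarrow> swap c d b a w \<in> Trl A"
  by (auto simp: swap_def transport_def moves_def)

lemma swap_last: "w \<noteq> [] \<Longrightarrow> last (swap c d b a w) = last w"
  by (simp add: swap_def)

lemma swap_tr_upd:
  assumes "w \<noteq> []"
  shows "swap c d b a (tr_upd w i) = tr_upd (swap c d b a w) i"
proof -
  obtain w' t k where w: "w = w' @ [(t, k)]" using assms by (metis append_butlast_last_id surj_pair)
  then have "fst (hd (tr_upd w i)) = fst (hd w)" by (simp add: hd_append)
  then show ?thesis using w by (simp add: swap_def flip: append_assoc)
qed

lemma swap_trail_eq:
  assumes "transport A c d b a" "trail_eq A p q"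
  shows "trail_eq A (swap c d b a p) (swap c d b a q)"
proof -
  have "moves A c b a" "moves A d a b" using assms(1) by (simp_all add: transport_def)
  note eq = this[THEN moves_trail_eq, OF assms(2)]
  show ?thesis
    using eq assms(2) trail_eq_start[OF assms(2)] unfolding swap_def by presburger
qed

text \<open>The inverse exchanges prefixes and start vertices together. This also covers
  \<open>a = b\<close>, where the first branch wins on both sides and applies \<open>c\<close> and
  then \<open>d\<close>.\<close>

lemma swap_swap:
  assumes "transport A c d b a" "w \<in> Trl A"
  shows "trail_eq A (swap d c a b (swap c d b a w)) w"
  using assms teq_refl[of w A] by (auto simp: swap_def transport_def moves_def)

text \<open>The union over all representatives avoids choosing one; when \<open>\<tau>\<close>
  respects equivalence, its members coincide on each class.\<close>

definition act :: "('a, 'm) wa_alg_scheme \<Rightarrow> ('a trail \<Rightarrow> 'a trail) \<Rightarrow> 'a trail set \<Rightarrow> 'a trail set" where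
  "act A \<tau> X = (\<Union>w\<in>X. trail_cls A (\<tau> w))"

lemma act_swap:
  assumes "transport A c d b a" "w \<in> Trl A"
  shows "act A (swap c d b a) (trail_cls A w) = trail_cls A (swap c d b a w)"
proof -
  have "trail_cls A (swap c d b a w') = trail_cls A (swap c d b a w)" if "w' \<in> trail_cls A w" for w'
    using that assms swap_trail_eq swap_Trl trail_eq_Trl
    by (metis mem_Collect_eq teq_sym trail_cls_def trail_cls_eq_iff)
  moreover have "w \<in> trail_cls A w" using assms teq_refl by (auto simp: trail_cls_def)
  ultimately show ?thesis unfolding act_def by blast
qed

lemma act_swap_UB: "transport A c d b a \<Longrightarrow> x \<in> UB A \<Longrightarrow> act A (swap c d b a) x \<in> UB A"
  by (auto simp: UB_def act_swap swap_Trl)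

lemma act_swap_swap:
  assumes "transport A c d b a" "x \<in> UB A"
  shows "act A (swap d c a b) (act A (swap c d b a) x) = x"
proof -
  obtain w where w: "w \<in> Trl A" "x = trail_cls A w" using assms by (auto simp: UB_def)
  then have "act A (swap d c a b) (act A (swap c d b a) x) = trail_cls A (swap d c a b (swap c d b a w))"
    using assms by (simp add: act_swap swap_Trl transport_sym)
  also have "\<dots> = x"
    using swap_swap[OF assms(1) w(1)] w trail_eq_Trl trail_cls_eq_iff by metis
  finally show ?thesis .
qed

subsection \<open>Invariance of completely generated sets\<close>

definition map3 :: "('u \<Rightarrow> 'v) \<Rightarrow> 'u \<times> 'u \<times> 'u \<Rightarrow> 'v \<times> 'v \<times> 'v" where
  "map3 g = map_prod g (map_prod g g)"

lemma tc_map3 [simp]: "tc (map3 g v) k = g (tc v k)"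
  by (cases v) (simp add: map3_def tc_def)

lemma all_less_3_iff: "(\<forall>k<3. P k) \<longleftrightarrow> P 0 \<and> P 1 \<and> P (2::nat)"
  by (auto simp: less_3_iff)

lemma cube_iff: "v \<in> cube U \<longleftrightarrow> (\<forall>k<3. tc v k \<in> U)"
  by (cases v) (simp add: cube_def all_less_3_iff)

lemma cgen_subset_cube:
  assumes "X \<in> cgen U G" "\<And>X. X \<in> G \<Longrightarrow> X \<subseteq> cube U"
  shows "X \<subseteq> cube U"
  using assms(1) by induction (use assms(2) in \<open>auto simp: diag_def cyl_def\<close>)

text \<open>The inverse \<open>h\<close> matters for diagonals, where it gives injectivity of
  \<open>g\<close>, and for cylindrification, where a witness for the image of \<open>v\<close> is
  pulled back to one for \<open>v\<close>.\<close>

lemma cgen_invariant: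
  assumes G: "\<And>X. X \<in> G \<Longrightarrow> X \<subseteq> cube U"
    and g: "\<And>x. x \<in> U \<Longrightarrow> g x \<in> U" "\<And>x. x \<in> U \<Longrightarrow> h (g x) = x"
    and h: "\<And>x. x \<in> U \<Longrightarrow> h x \<in> U" "\<And>x. x \<in> U \<Longrightarrow> g (h x) = x"
    and inv: "\<And>X v. X \<in> G \<Longrightarrow> v \<in> cube U \<Longrightarrow> map3 g v \<in> X \<longleftrightarrow> v \<in> X"
    and X: "X \<in> cgen U G" and v: "v \<in> cube U"
  shows "map3 g v \<in> X \<longleftrightarrow> v \<in> X"
  using X v
proof (induction arbitrary: v)
  case (cgen_gen X)
  then show ?case using inv by blast
next
  case (cgen_diag k l)
  then show ?case using g unfolding diag_def cube_iff by (auto dest: arg_cong[of _ _ h])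
next
  case (cgen_compl X)
  then show ?case using g by (auto simp: cube_iff)
next
  case (cgen_cyl X k)
  have gv: "map3 g v \<in> cube U" using cgen_cyl g by (simp add: cube_iff)
  have X: "X \<subseteq> cube U" using cgen_subset_cube[OF cgen_cyl.hyps(1) G] .
  show ?case
  proof
    assume "map3 g v \<in> cyl U k X"
    then obtain u where u: "u \<in> X" "\<forall>l<3. l \<noteq> k \<longrightarrow> tc u l = g (tc v l)"
      by (auto simp: cyl_def)
    have hu: "map3 h u \<in> cube U" using u X h by (auto simp: cube_iff)
    have "map3 g (map3 h u) = u"
      using u X h by (intro tc_eqI) (auto simp: cube_iff)
    then have "map3 h u \<in> X" using cgen_cyl.IH[OF hu] u by simp
    moreover have "\<forall>l<3. l \<noteq> k \<longrightarrow> tc (map3 h u) l = tc v l"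
      using u cgen_cyl.prems g by (simp add: cube_iff)
    ultimately show "v \<in> cyl U k X" using cgen_cyl.prems unfolding cyl_def by blast
  next
    assume "v \<in> cyl U k X"
    then obtain u where u: "u \<in> X" "\<forall>l<3. l \<noteq> k \<longrightarrow> tc u l = tc v l"
      by (auto simp: cyl_def)
    then have "map3 g u \<in> X" using cgen_cyl.IH X by blast
    moreover have "\<forall>l<3. l \<noteq> k \<longrightarrow> tc (map3 g u) l = tc (map3 g v) l"
      using u by simp
    ultimately show "map3 g v \<in> cyl U k X" using gv unfolding cyl_def by blast
  qed
next
  case (cgen_Union S)
  then show ?case by blast
qed

subsection \<open>Triples of points of a trail\<close>

definition pts :: "('a, 'm) wa_alg_scheme \<Rightarrow> 'a trail \<Rightarrow> 'a trail set \<times> 'a trail set \<times> 'a trail set" where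
  "pts A p = (trail_cls A (tr_upd p 0), trail_cls A (tr_upd p 1), trail_cls A (tr_upd p 2))"

lemma tc_pts: "k < 3 \<Longrightarrow> tc (pts A p) k = trail_cls A (tr_upd p k)"
  by (auto simp: pts_def less_3_iff)

lemma RB_iff: "v \<in> RB A t \<longleftrightarrow> (\<exists>p\<in>Trl A. fst (last p) = t \<and> v = pts A p)"
  by (auto simp: RB_def pts_def ends_at_def)

lemma pts_cube: "p \<in> Trl A \<Longrightarrow> pts A p \<in> cube (UB A)"
  by (auto simp: cube_iff tc_pts UB_def intro!: tr_upd_Trl)

lemma RB_cube: "RB A t \<subseteq> cube (UB A)"
  by (auto simp: RB_iff pts_cube)

lemma map3_act_pts:
  assumes "transport A c d b a" "p \<in> Trl A"
  shows "map3 (act A (swap c d b a)) (pts A p) = pts A (swap c d b a p)"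
  using assms Trl_nonempty[OF assms(2)]
  by (intro tc_eqI) (simp add: tc_pts act_swap tr_upd_Trl swap_tr_upd)

lemma map3_act_RB:
  assumes "transport A c d b a" "v \<in> RB A t"
  shows "map3 (act A (swap c d b a)) v \<in> RB A t"
proof -
  obtain p where p: "p \<in> Trl A" "fst (last p) = t" "v = pts A p" using assms(2) by (auto simp: RB_iff)
  then have "map3 (act A (swap c d b a)) v = pts A (swap c d b a p)"
    using map3_act_pts assms(1) by blast
  moreover have "fst (last (swap c d b a p)) = t"
    using swap_last Trl_nonempty p by metis
  ultimately show ?thesis using swap_Trl[OF assms(1) p(1)] unfolding RB_iff by blast
qed

lemma act_swap_invariant:
  assumes T: "transport A c d b a" and X: "X \<in> cgen (UB A) (RB A ` S)" and v: "v \<in> cube (UB A)"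
  shows "map3 (act A (swap c d b a)) v \<in> X \<longleftrightarrow> v \<in> X"
proof (rule cgen_invariant[where h = "act A (swap d c a b)", OF _ _ _ _ _ _ X v])
  note T' = transport_sym[OF T]
  fix Y v assume Y: "Y \<in> RB A ` S" and v: "v \<in> cube (UB A)"
  have "map3 (act A (swap d c a b)) (map3 (act A (swap c d b a)) v) = v"
    using v act_swap_swap[OF T] by (intro tc_eqI) (simp add: cube_iff)
  then show "map3 (act A (swap c d b a)) v \<in> Y \<longleftrightarrow> v \<in> Y"
    using map3_act_RB[OF T] map3_act_RB[OF T'] Y by (metis imageE)
qed (use T RB_cube transport_sym[OF T] act_swap_UB act_swap_swap in blast)+

lemma RB_subset_of_meets:
  assumes X: "X \<in> cgen (UB A) (RB A ` S)" and v: "v \<in> RB A t" "v \<in> X"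
  shows "RB A t \<subseteq> X"
proof
  fix u assume "u \<in> RB A t"
  then obtain q where q: "q \<in> Trl A" "fst (last q) = t" "u = pts A q" by (auto simp: RB_iff)
  obtain p where p: "p \<in> Trl A" "fst (last p) = t" "v = pts A p" using v by (auto simp: RB_iff)
  obtain r j where r: "p = rev r @ [(t, j)]" "rtrail A r t" using p(1,2) by (auto elim: Trl_cases)
  obtain r' j' where r': "q = rev r' @ [(t, j')]" "rtrail A r' t" using q(1,2) by (auto elim: Trl_cases)
  let ?a = "fst (hd p)" and ?b = "fst (hd q)"
  obtain d where d: "transport A (rev r) d ?a t" using rtrail_transport[OF r(2)] r(1) by blast
  obtain d' where d': "transport A (rev r') d' ?b t" using rtrail_transport[OF r'(2)] r'(1) by blast
  \<comment> \<open>Prefixed to \<open>p\<close>, \<open>?c\<close> follows the edges of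
    \<open>q\<close> and then undoes those of \<open>p\<close>; what remains after cancellation is
    \<open>q\<close> with the same final index.\<close>
  let ?c = "rev r' @ d" and ?d = "rev r @ d'"
  have T: "transport A ?c ?d ?b ?a"
    using transport_trans[OF d' transport_sym[OF d]] .
  have "trail_eq A (tr_upd (swap ?c ?d ?b ?a p) k) (tr_upd q k)" if k: "k < 3" for k
  proof -
    have tk: "[(t, k)] \<in> Trl A" using Trl_snoc_iff[of "[]" t k A] k rtrail_suitB[OF r(2)] by simp
    then have "trail_eq A (d @ rev r @ [(t, k)]) [(t, k)]"
      using d unfolding transport_def by simp
    moreover have "fst (hd (d @ rev r @ [(t, k)])) = t"
      using trail_eq_start calculation by fastforce
    ultimately have "trail_eq A (rev r' @ d @ rev r @ [(t, k)]) (rev r' @ [(t, k)])"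
      using moves_trail_eq d' unfolding transport_def by blast
    then show ?thesis using r r' by (simp add: swap_def flip: append_assoc)
  qed
  then have "pts A (swap ?c ?d ?b ?a p) = u"
    unfolding q(3) by (intro tc_eqI) (metis tc_pts trail_cls_eq_iff trail_eq_Trl)
  then have "map3 (act A (swap ?c ?d ?b ?a)) v = u"
    using map3_act_pts[OF T p(1)] p(3) by simp
  then show "u \<in> X"
    using act_swap_invariant[OF T X] v(2) pts_cube[OF p(1)] p(3) by metis
qed

subsection \<open>The relativized algebra as the complex algebra of the suitable structure\<close>

definition RU :: "('a, 'm) wa_alg_scheme \<Rightarrow> ('a \<times> 'a \<times> 'a) set
    \<Rightarrow> ('a trail set \<times> 'a trail set \<times> 'a trail set) set" where
  "RU A S = (\<Union>t\<in>S. RB A t)"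

lemma RU_iff: "v \<in> RU A S \<longleftrightarrow> (\<exists>p\<in>Trl A. fst (last p) \<in> S \<and> v = pts A p)"
  unfolding RU_def UN_iff RB_iff by blast

lemma VB_RU: "VB A = RU A (suitB A)"
  by (simp add: VB_def RU_def)

lemma RU_union: "RU A (S \<union> S') = RU A S \<union> RU A S'"
  by (auto simp: RU_def)

lemma RU_mono: "S \<subseteq> S' \<Longrightarrow> RU A S \<subseteq> RU A S'"
  by (auto simp: RU_def)

lemma RU_cgen: "S \<subseteq> suitB A \<Longrightarrow> RU A S \<in> cgen (UB A) (RB A ` suitB A)"
  unfolding RU_def by (intro cgen_Union cgen_gen) auto

lemma RB_RU: "RB A t = RU A {t}"
  by (simp add: RU_def)

lemma Trl_last_suitB: "p \<in> Trl A \<Longrightarrow> fst (last p) \<in> suitB A"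
  by (elim Trl_cases) (simp add: rtrail_suitB)

lemma singleton_Trl: "t \<in> suitB A \<Longrightarrow> [(t, 0)] \<in> Trl A"
  using Trl_snoc_iff[of "[]" t 0 A] by simp

text \<open>A generated set inside \<open>VB A\<close> is the union of the \<open>RB A t\<close> it
  meets, because meeting one means containing it. Conversely all such unions are generated by
  closure under arbitrary unions.\<close>

lemma ccar_Rl:
  "ccar (Rl (UB A) (VB A) (cgen (UB A) (RB A ` suitB A))) = RU A ` Pow (suitB A)"
proof (intro equalityI subsetI)
  fix X assume "X \<in> ccar (Rl (UB A) (VB A) (cgen (UB A) (RB A ` suitB A)))"
  then have X: "X \<in> cgen (UB A) (RB A ` suitB A)" "X \<subseteq> RU A (suitB A)"
    by (simp_all add: Rl_def VB_RU)
  let ?S = "{t \<in> suitB A. RB A t \<subseteq> X}"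
  have "X \<subseteq> RU A ?S"
  proof
    fix v assume v: "v \<in> X"
    then obtain t where t: "t \<in> suitB A" "v \<in> RB A t"
      using X(2) unfolding RU_def by blast
    then have "RB A t \<subseteq> X" using RB_subset_of_meets[OF X(1) t(2) v] by simp
    then show "v \<in> RU A ?S" using t unfolding RU_def by blast
  qed
  moreover have "RU A ?S \<subseteq> X" unfolding RU_def by blast
  ultimately have "X = RU A ?S" ..
  then show "X \<in> RU A ` Pow (suitB A)" by blast
next
  fix X assume "X \<in> RU A ` Pow (suitB A)"
  then show "X \<in> ccar (Rl (UB A) (VB A) (cgen (UB A) (RB A ` suitB A)))"
    using RU_cgen RU_mono[of _ "suitB A" A] by (simp add: Rl_def VB_RU) blast
qed

section \<open>Relativized operations on unions of the \<open>RB A t\<close>\<close>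

context atomic_weakly_associative
begin

lemma pts_eq_last:
  assumes "p \<in> Trl A" "q \<in> Trl A" "pts A p = pts A q"
  shows "fst (last p) = fst (last q)"
proof -
  have "trail_eq A (tr_upd p l) (tr_upd q l)" if "l < 3" for l
    using assms that tc_pts[of l A] trail_cls_eq_iff tr_upd_Trl by metis
  then show ?thesis
    using tr_upd_eq_suitT[OF assms(1,2)] by (intro tc_eqI) (simp add: suitT_iff)
qed

lemma pts_RU_iff: "p \<in> Trl A \<Longrightarrow> pts A p \<in> RU A S \<longleftrightarrow> fst (last p) \<in> S"
  using pts_eq_last unfolding RU_iff by metis

lemma RU_subset_iff:
  assumes "S \<subseteq> suitB A"
  shows "RU A S \<subseteq> RU A S' \<longleftrightarrow> S \<subseteq> S'"
proof
  assume sub: "RU A S \<subseteq> RU A S'"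
  show "S \<subseteq> S'"
  proof
    fix t assume "t \<in> S"
    then have "[(t, 0)] \<in> Trl A" using assms singleton_Trl by blast
    from pts_RU_iff[OF this] show "t \<in> S'" using sub \<open>t \<in> S\<close> by auto
  qed
qed (rule RU_mono)

lemma RU_eq_iff: "S \<subseteq> suitB A \<Longrightarrow> S' \<subseteq> suitB A \<Longrightarrow> RU A S = RU A S' \<longleftrightarrow> S = S'"
  using RU_subset_iff[of S S'] RU_subset_iff[of S' S] by blast

lemma RU_diff: "RU A S - RU A S' = RU A (S - S')"
proof (intro equalityI subsetI)
  fix v assume v: "v \<in> RU A S - RU A S'"
  then obtain p where p: "p \<in> Trl A" "fst (last p) \<in> S" "v = pts A p" unfolding RU_iff Diff_iff by blast
  then show "v \<in> RU A (S - S')" using v pts_RU_iff[OF p(1)] by simp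
next
  fix v assume "v \<in> RU A (S - S')"
  then obtain p where p: "p \<in> Trl A" "fst (last p) \<in> S - S'" "v = pts A p" unfolding RU_iff by blast
  then show "v \<in> RU A S - RU A S'" using pts_RU_iff[OF p(1)] by simp
qed

text \<open>From left to right, two shared points determine component \<open>k\<close>. From right
  to left, one more edge of label \<open>k\<close> reaches the triangle \<open>s\<close>, and rule
  (b) keeps the points other than \<open>k\<close>.\<close>

lemma cyl_RU:
  assumes S: "S \<subseteq> suitB A" and k: "k < 3"
  shows "VB A \<inter> cyl (UB A) k (RU A S) = RU A (suitT A k `` S)"
proof (intro equalityI subsetI)
  fix v assume "v \<in> VB A \<inter> cyl (UB A) k (RU A S)"
  then obtain p q where p: "p \<in> Trl A" "v = pts A p" and q: "q \<in> Trl A" "fst (last q) \<in> S"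
    and eq: "\<forall>l<3. l \<noteq> k \<longrightarrow> tc (pts A q) l = tc (pts A p) l"
    unfolding VB_RU cyl_def Int_iff mem_Collect_eq Bex_def RU_iff by blast
  have "trail_eq A (tr_upd q l) (tr_upd p l)" if "l < 3" "l \<noteq> k" for l
    using eq that q(1) trail_cls_eq_iff tr_upd_Trl by (metis tc_pts)
  then have "(fst (last q), fst (last p)) \<in> suitT A k"
    using tr_upd_eq_suitT[OF q(1) p(1) k] by blast
  then show "v \<in> RU A (suitT A k `` S)"
    using p q unfolding RU_iff by blast
next
  fix v assume "v \<in> RU A (suitT A k `` S)"
  then obtain p s where p: "p \<in> Trl A" "v = pts A p" and s: "s \<in> S" "(s, fst (last p)) \<in> suitT A k"
    unfolding RU_iff by blast
  have "\<exists>q\<in>Trl A. fst (last q) \<in> S \<and> (\<forall>l<3. l \<noteq> k \<longrightarrow> tc (pts A q) l = tc (pts A p) l)"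
  \<comment> \<open>Consecutive vertices of a trail must differ, so \<open>s\<close> can be appended
    only if it is a new triangle; otherwise \<open>p\<close> itself is the witness.\<close>
  proof (cases "s = fst (last p)")
    case True
    then show ?thesis using p s by blast
  next
    case False
    obtain r t j where r: "p = rev r @ [(t, j)]" "rtrail A r t" using p(1) by (elim Trl_cases) blast
    have "(t, s) \<in> suitT A k" "t \<noteq> s" using s(2) False r(1) by (auto simp: suitT_iff)
    then have q: "rev ((t, k) # r) @ [(s, l)] \<in> Trl A" if "l < 3" for l
      using that r(2) k unfolding Trl_snoc_iff by simp
    have "trail_eq A (rev r @ [(t, k), (s, l)]) (rev r @ [(t, l)])" if "l < 3" "l \<noteq> k" for l
      using trail_eq_move[of k l "rev r" t s A] q[OF that(1)] that tr_upd_Trl[OF p(1)] r(1)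
      by (metis append_Cons append_Nil append_assoc rev.simps(2) tr_upd_snoc)
    then have "tc (pts A (rev ((t, k) # r) @ [(s, 0)])) l = tc (pts A p) l" if "l < 3" "l \<noteq> k" for l
      using that q[OF that(1)] r(1) tr_upd_snoc[of "rev r @ [(t, k)]" s 0 l]
      by (simp add: tc_pts trail_cls_eq_iff)
    then show ?thesis using q[of 0] s(1) by (intro bexI[of _ "rev ((t, k) # r) @ [(s, 0)]"]) auto
  qed
  moreover have "v \<in> cube (UB A)" using pts_cube p by blast
  moreover have "v \<in> VB A" using p Trl_last_suitB unfolding VB_RU RU_iff by blast
  ultimately show "v \<in> VB A \<inter> cyl (UB A) k (RU A S)"
    unfolding cyl_def Int_iff mem_Collect_eq Bex_def RU_iff using p(2) by blast
qed

lemma diag_RU: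
  assumes "k < 3" "l < 3"
  shows "VB A \<inter> diag (UB A) k l = RU A (suitE A k l)"
proof -
  have "tc (pts A p) k = tc (pts A p) l \<longleftrightarrow> fst (last p) \<in> suitE A k l" if "p \<in> Trl A" for p
    using tr_upd_eq_suitE[OF that assms] assms that by (simp add: tc_pts trail_cls_eq_iff tr_upd_Trl)
  then show ?thesis
    using pts_cube Trl_last_suitB
    unfolding VB_RU diag_def set_eq_iff Int_iff mem_Collect_eq RU_iff by blast
qed

lemma set_atoms_RU: "set_atoms (RU A ` Pow (suitB A)) = RB A ` suitB A"
proof (intro equalityI subsetI)
  fix X assume X: "X \<in> set_atoms (RU A ` Pow (suitB A))"
  then obtain S where S: "S \<subseteq> suitB A" "X = RU A S" by (auto simp: set_atoms_def)
  have "X \<noteq> {}" using X by (simp add: set_atoms_def)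
  then obtain t where t: "t \<in> S" using S by (auto simp: RU_def)
  then have "RU A {t} \<subseteq> X" "RU A {t} \<in> RU A ` Pow (suitB A)" "RU A {t} \<noteq> {}"
    using S RU_mono[of "{t}" S A] RU_subset_iff[of "{t}" "{}"] by (auto simp: RU_def)
  then have "X = RB A t"
    using X unfolding set_atoms_def RB_RU by blast
  then show "X \<in> RB A ` suitB A" using t S by blast
next
  fix X assume "X \<in> RB A ` suitB A"
  then obtain t where t: "t \<in> suitB A" "X = RU A {t}" by (auto simp: RB_RU)
  then have "X \<noteq> {}" using RU_subset_iff[of "{t}" "{}"] by (auto simp: RU_def)
  moreover have "Y = {} \<or> Y = X" if "Y \<in> RU A ` Pow (suitB A)" "Y \<subseteq> X" for Y
  proof -
    from that(1) obtain S where "S \<in> Pow (suitB A)" "Y = RU A S" by (elim imageE)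
    then have S: "S \<subseteq> suitB A" "Y = RU A S" by simp_all
    then have "S \<subseteq> {t}" using that(2) t RU_subset_iff[of S "{t}"] by simp
    then have "S = {} \<or> S = {t}" by blast
    then show ?thesis using S t by (auto simp: RU_def)
  qed
  ultimately show "X \<in> set_atoms (RU A ` Pow (suitB A))"
    using t unfolding set_atoms_def by blast
qed

subsection \<open>The isomorphism\<close>

abbreviation RlC :: "('a trail set \<times> 'a trail set \<times> 'a trail set) set ca" where
  "RlC \<equiv> Rl (UB A) (VB A) (cgen (UB A) (RB A ` suitB A))"

lemma Rl_simps:
  "cplus RlC = (\<union>)" "ccompl RlC = (\<lambda>X. VB A - X)"
  "ccyl RlC = (\<lambda>k X. VB A \<inter> cyl (UB A) k X)" "cdiag RlC = (\<lambda>k l. VB A \<inter> diag (UB A) k l)"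
  by (simp_all add: Rl_def)

lemma ccompl_RU: "S \<subseteq> suitB A \<Longrightarrow> ccompl RlC (RU A S) = RU A (suitB A - S)"
  unfolding Rl_simps by (simp add: VB_RU RU_diff)

lemma cmeet_RU:
  assumes "S \<subseteq> suitB A" "S' \<subseteq> suitB A"
  shows "cmeet RlC (RU A S) (RU A S') = RU A (S \<inter> S')"
proof -
  have "suitB A - ((suitB A - S) \<union> (suitB A - S')) = S \<inter> S'"
    using assms by blast
  then show ?thesis
    unfolding cmeet_def Rl_simps by (simp add: VB_RU RU_diff flip: RU_union)
qed

lemma ccyl_RU: "S \<subseteq> suitB A \<Longrightarrow> k < 3 \<Longrightarrow> ccyl RlC k (RU A S) = RU A (suitT A k `` S)"
  unfolding Rl_simps by (rule cyl_RU)

lemma cdiag_RU: "k < 3 \<Longrightarrow> l < 3 \<Longrightarrow> cdiag RlC k l = RU A (suitE A k l)"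
  unfolding Rl_simps by (rule diag_RU)

lemma suitT_subset: "suitT A k `` S \<subseteq> suitB A"
  by (auto simp: suitT_iff)

lemma suitE_subset: "suitE A k l \<subseteq> suitB A"
  using suitE_sub by blast

text \<open>With \<open>k = 2\<close> this gives the image of \<open>x\<close> under the
  isomorphism; the other values of \<open>k\<close> occur as intermediate results in the terms for
  composition and converse.\<close>

definition edge_below :: "nat \<Rightarrow> 'a \<Rightarrow> ('a \<times> 'a \<times> 'a) set" where
  "edge_below k x = {t \<in> suitB A. tc t k \<preceq> x}"

lemma edge_below_subset: "edge_below k x \<subseteq> suitB A"
  by (auto simp: edge_below_def)

lemma edge_below_compl:
  "x \<in> \<K> \<Longrightarrow> k < 3 \<Longrightarrow> edge_below k (\<ominus> x) = suitB A - edge_below k x"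
  by (auto simp: edge_below_def At_neg_iff suitB_tc)

lemma edge_below_add:
  "x \<in> \<K> \<Longrightarrow> y \<in> \<K> \<Longrightarrow> k < 3 \<Longrightarrow> edge_below k (x \<oplus> y) = edge_below k x \<union> edge_below k y"
  by (auto simp: edge_below_def At_add_iff suitB_tc)

lemma edge_below_id: "edge_below 2 \<e> = suitE A 0 1"
  by (simp add: edge_below_def suitE_def)

lemma suitT_edge_below: "suitT A k `` edge_below k x = edge_below k x"
  by (auto simp: edge_below_def suitT_iff)

text \<open>Each atom labels a triangle with two coinciding points. These triangles are the
  witnesses for substituting one point for another.\<close>

lemma degenerate_12: "a \<in> wa_At A \<Longrightarrow> (dm (a\<acute>), a, a) \<in> suitE A 1 2"
  by (simp add: suitE_def suitB_iff mul_dm_cnv idAt_leq dm)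

lemma degenerate_02: "a \<in> wa_At A \<Longrightarrow> (a\<acute>, dm a, a) \<in> suitE A 0 2"
  by (simp add: suitE_def suitB_iff dm_leq_mul_cnv idAt_leq dm)

lemma degenerate_01: "a \<in> wa_At A \<Longrightarrow> (a, a, dm a) \<in> suitE A 0 1"
  by (simp add: suitE_def suitB_iff idAt_leq dm)

lemma suitE_12_tc: "s \<in> suitE A 1 2 \<Longrightarrow> tc s 1 = tc s 2"
  using suitE_lab[of s 1 2 0] lab_cnv[of s 0 1] lab_cnv[of s 0 2] suitE_sub[of s A]
  by (simp add: lab_def) (metis At_closed cnv_cnv less_3_iff suitB_tc One_nat_def)

lemma suitE_02_tc: "s \<in> suitE A 0 2 \<Longrightarrow> tc s 0 = (tc s 2)\<acute>"
  using suitE_lab[of s 0 2 1] suitE_sub[of s A] suitB_tc[of s 0]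
  by (auto simp add: lab_def)

lemma suitE_01_tc: "s \<in> suitE A 0 1 \<Longrightarrow> tc s 0 = tc s 1"
  using suitE_lab[of s 0 1 2] by (simp add: lab_def)

lemma cyl_12: "suitT A 1 `` (suitE A 1 2 \<inter> edge_below 2 x) = edge_below 1 x"
proof (intro equalityI subsetI)
  fix t assume "t \<in> suitT A 1 `` (suitE A 1 2 \<inter> edge_below 2 x)"
  then obtain s where s: "s \<in> suitE A 1 2" "tc s 2 \<preceq> x" "t \<in> suitB A" "tc s 1 = tc t 1"
    unfolding edge_below_def Image_iff suitT_iff by blast
  then show "t \<in> edge_below 1 x"
    using suitE_12_tc[OF s(1)] by (simp add: edge_below_def)
next
  fix t assume t: "t \<in> edge_below 1 x"
  let ?a = "tc t 1"
  have "?a \<in> wa_At A" using t suitB_tc by (simp add: edge_below_def)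
  note s = degenerate_12[OF this]
  have "((dm (?a\<acute>), ?a, ?a), t) \<in> suitT A 1" "(dm (?a\<acute>), ?a, ?a) \<in> edge_below 2 x"
    using t suitE_sub[OF s] by (simp_all add: edge_below_def suitT_iff)
  then show "t \<in> suitT A 1 `` (suitE A 1 2 \<inter> edge_below 2 x)" using s by blast
qed

text \<open>Substituting point 2 for point 0 turns the edge from 0 to 1 into one from 2 to 1.
  Components are read in increasing direction, hence the converse.\<close>

lemma cyl_02:
  assumes x: "x \<in> \<K>"
  shows "suitT A 0 `` (suitE A 0 2 \<inter> edge_below 2 x) = edge_below 0 (x\<acute>)"
proof (intro equalityI subsetI)
  fix t assume "t \<in> suitT A 0 `` (suitE A 0 2 \<inter> edge_below 2 x)"
  then obtain s where s: "s \<in> suitE A 0 2" "tc s 2 \<preceq> x" "s \<in> suitB A" "t \<in> suitB A" "tc s 0 = tc t 0"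
    unfolding edge_below_def Image_iff suitT_iff by blast
  then have "tc t 0 \<preceq> x\<acute>"
    using suitE_02_tc[OF s(1)] cnv_mono[OF s(2)] suitB_tc[of s 2] x by auto
  then show "t \<in> edge_below 0 (x\<acute>)" using s by (simp add: edge_below_def)
next
  fix t assume t: "t \<in> edge_below 0 (x\<acute>)"
  let ?a = "(tc t 0)\<acute>"
  have At: "tc t 0 \<in> wa_At A" using t suitB_tc by (simp add: edge_below_def)
  then have "?a \<in> wa_At A" by simp
  note s = degenerate_02[OF this]
  have "((?a\<acute>, dm ?a, ?a), t) \<in> suitT A 0" "(?a\<acute>, dm ?a, ?a) \<in> edge_below 2 x"
    using t suitE_sub[OF s] At x by (simp_all add: edge_below_def suitT_iff cnv_leq_swap)
  then show "t \<in> suitT A 0 `` (suitE A 0 2 \<inter> edge_below 2 x)" using s by blast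
qed

lemma cyl_01: "suitT A 0 `` (suitE A 0 1 \<inter> edge_below 1 x) = edge_below 0 x"
proof (intro equalityI subsetI)
  fix t assume "t \<in> suitT A 0 `` (suitE A 0 1 \<inter> edge_below 1 x)"
  then obtain s where s: "s \<in> suitE A 0 1" "tc s 1 \<preceq> x" "t \<in> suitB A" "tc s 0 = tc t 0"
    unfolding edge_below_def Image_iff suitT_iff by blast
  then show "t \<in> edge_below 0 x"
    using suitE_01_tc[OF s(1)] by (simp add: edge_below_def)
next
  fix t assume t: "t \<in> edge_below 0 x"
  let ?a = "tc t 0"
  have "?a \<in> wa_At A" using t suitB_tc by (simp add: edge_below_def)
  note s = degenerate_01[OF this]
  have "((?a, ?a, dm ?a), t) \<in> suitT A 0" "(?a, ?a, dm ?a) \<in> edge_below 1 x"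
    using t suitE_sub[OF s] by (simp_all add: edge_below_def suitT_iff)
  then show "t \<in> suitT A 0 `` (suitE A 0 1 \<inter> edge_below 1 x)" using s by blast
qed

lemma cyl_20:
  assumes x: "x \<in> \<K>"
  shows "suitT A 2 `` (suitE A 2 0 \<inter> edge_below 0 x) = edge_below 2 (x\<acute>)"
proof (intro equalityI subsetI)
  fix t assume "t \<in> suitT A 2 `` (suitE A 2 0 \<inter> edge_below 0 x)"
  then obtain s where s: "s \<in> suitE A 2 0" "tc s 0 \<preceq> x" "s \<in> suitB A" "t \<in> suitB A" "tc s 2 = tc t 2"
    unfolding edge_below_def Image_iff suitT_iff by blast
  then have "tc t 2 \<preceq> x\<acute>"
    using suitE_02_tc[OF suitE_sym[OF s(1)]] suitB_tc[of s 2] x by (simp add: cnv_leq_swap)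
  then show "t \<in> edge_below 2 (x\<acute>)" using s by (simp add: edge_below_def)
next
  fix t assume t: "t \<in> edge_below 2 (x\<acute>)"
  let ?a = "tc t 2"
  have At: "?a \<in> wa_At A" using t suitB_tc by (simp add: edge_below_def)
  note s = degenerate_02[OF this]
  have "((?a\<acute>, dm ?a, ?a), t) \<in> suitT A 2" "(?a\<acute>, dm ?a, ?a) \<in> edge_below 0 x"
    using t suitE_sub[OF s] At x by (simp_all add: edge_below_def suitT_iff cnv_leq_swap)
  then show "t \<in> suitT A 2 `` (suitE A 2 0 \<inter> edge_below 0 x)" using suitE_sym[OF s] by blast
qed

lemma cyl_mul:
  assumes x: "x \<in> \<K>" "y \<in> \<K>"
  shows "suitT A 2 `` (edge_below 1 x \<inter> edge_below 0 (y\<acute>)) = edge_below 2 (x \<odot> y)"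
proof (intro equalityI subsetI)
  fix t assume "t \<in> suitT A 2 `` (edge_below 1 x \<inter> edge_below 0 (y\<acute>))"
  then obtain s where s: "s \<in> suitB A" "tc s 1 \<preceq> x" "tc s 0 \<preceq> y\<acute>" "tc s 2 = tc t 2" "t \<in> suitB A"
    unfolding edge_below_def Image_iff suitT_iff by blast
  have At: "tc s 0 \<in> wa_At A" "tc s 1 \<in> wa_At A" "tc s 2 \<in> wa_At A" using suitB_tc[OF s(1)] by simp_all
  have "tc s 2 \<preceq> tc s 1 \<odot> (tc s 0)\<acute>"
    using s(1) At by (intro triangle') (simp_all add: suitB_def)
  moreover have "tc s 1 \<odot> (tc s 0)\<acute> \<preceq> x \<odot> y"
    using s At x by (intro mul_mono) (simp_all add: cnv_leq_swap)
  ultimately have "tc t 2 \<preceq> x \<odot> y"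
    using leq_trans s(4) At x by (metis At_closed cnv_closed mul_closed)
  then show "t \<in> edge_below 2 (x \<odot> y)" using s by (simp add: edge_below_def)
next
  fix t assume t: "t \<in> edge_below 2 (x \<odot> y)"
  then have At: "tc t 2 \<in> wa_At A" using suitB_tc by (simp add: edge_below_def)
  moreover have "tc t 2 \<preceq> x \<odot> y" using t by (simp add: edge_below_def)
  \<comment> \<open>The edge from 0 to 1 is factored through point 2: \<open>a\<close> runs from 0
    to 2 and \<open>b\<close> from 2 to 1, so the component at index 0 is
    \<open>b\<acute>\<close>.\<close>
  ultimately obtain a b where ab: "a \<in> wa_At A" "b \<in> wa_At A" "a \<preceq> x" "b \<preceq> y" "tc t 2 \<preceq> a \<odot> b"
    using mul_decomp x by metis
  then have "a \<preceq> tc t 2 \<odot> b\<acute>" using triangle' At by auto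
  then have s: "(b\<acute>, a, tc t 2) \<in> suitB A" using ab At by (simp add: suitB_iff)
  then have "(b\<acute>, a, tc t 2) \<in> edge_below 1 x \<inter> edge_below 0 (y\<acute>)"
    using ab x by (simp add: edge_below_def cnv_mono)
  moreover have "((b\<acute>, a, tc t 2), t) \<in> suitT A 2"
    using s t by (simp add: suitT_iff edge_below_def)
  ultimately show "t \<in> suitT A 2 `` (edge_below 1 x \<inter> edge_below 0 (y\<acute>))" by blast
qed

text \<open>The witness is the supremum of the labels occurring at index 2. An atom below it must be
  one of them, as otherwise its complement would be a smaller upper bound; closure under
  \<open>suitT A 2\<close> then recovers every triangle with that label.\<close>

lemma ex_edge_below:
  assumes "wa_complete A" "S \<subseteq> suitB A" "suitT A 2 `` S = S"
  shows "\<exists>x\<in>\<K>. edge_below 2 x = S"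
proof -
  let ?Z = "(\<lambda>t. tc t 2) ` S"
  have Z: "?Z \<subseteq> wa_At A" using assms(2) suitB_tc[where k = 2, simplified] by blast
  then have "?Z \<subseteq> \<K>" using At_closed by blast
  from assms(1)[unfolded wa_complete_def, rule_format, OF this]
  obtain s where "s \<in> \<K>" "\<forall>z\<in>?Z. z \<preceq> s" "\<forall>u\<in>\<K>. (\<forall>z\<in>?Z. z \<preceq> u) \<longrightarrow> s \<preceq> u"
    by blast
  then have s: "s \<in> \<K>" "\<And>z. z \<in> ?Z \<Longrightarrow> z \<preceq> s"
    "\<And>u. u \<in> \<K> \<Longrightarrow> (\<And>z. z \<in> ?Z \<Longrightarrow> z \<preceq> u) \<Longrightarrow> s \<preceq> u"
    by blast+
  have "edge_below 2 s = S"
  proof (intro equalityI subsetI)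
    fix t assume t: "t \<in> edge_below 2 s"
    then have At: "tc t 2 \<in> wa_At A" using suitB_tc by (simp add: edge_below_def)
    have "tc t 2 \<in> ?Z"
    proof (rule ccontr)
      assume n: "tc t 2 \<notin> ?Z"
      have "z \<preceq> \<ominus> (tc t 2)" if "z \<in> ?Z" for z
      proof -
        have "z \<in> wa_At A" "z \<noteq> tc t 2" using that n Z by blast+
        then show ?thesis using At_neg_iff[of z "tc t 2"] At_leq_At[of z "tc t 2"] At by blast
      qed
      then have "s \<preceq> \<ominus> (tc t 2)" using s(3) At by simp
      then have "tc t 2 \<preceq> \<ominus> (tc t 2)"
        using t leq_trans[of "tc t 2" s] s(1) At by (simp add: edge_below_def)
      then show False using At by (simp add: At_neg_iff)
    qed
    then obtain u where "u \<in> S" "tc u 2 = tc t 2" by auto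
    then have "(u, t) \<in> suitT A 2" using t assms(2) by (auto simp: suitT_iff edge_below_def)
    then show "t \<in> S" using assms(3) \<open>u \<in> S\<close> by blast
  next
    fix t assume "t \<in> S"
    then show "t \<in> edge_below 2 s" using assms(2) s(2) by (auto simp: edge_below_def)
  qed
  then show ?thesis using s(1) by blast
qed

lemma edge_below_inj:
  assumes "x \<in> \<K>" "y \<in> \<K>" "edge_below 2 x = edge_below 2 y"
  shows "x = y"
proof (rule eq_by_At)
  fix a assume "a \<in> wa_At A"
  \<comment> \<open>Every atom occurs at index 2 of some triangle, so the sets detect all
    atoms.\<close>
  then have "(dm (a\<acute>), a, a) \<in> suitB A" using degenerate_12 suitE_sub by blast
  then have "(dm (a\<acute>), a, a) \<in> edge_below 2 z \<longleftrightarrow> a \<preceq> z" for z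
    by (simp add: edge_below_def)
  then show "a \<preceq> x \<longleftrightarrow> a \<preceq> y" using assms(3) by blast
qed (use assms in simp_all)

lemma wa_iso_Ra:
  assumes "wa_complete A"
  shows "wa_iso A (Ra RlC)"
proof -
  let ?f = "\<lambda>x. RU A (edge_below 2 x)"
  note RU = cmeet_RU ccyl_RU cdiag_RU edge_below_subset suitT_subset suitE_subset le_infI1
  have car: "wcar (Ra RlC) = {RU A S | S. S \<subseteq> suitB A \<and> suitT A 2 `` S = S}"
  proof -
    have "wcar (Ra RlC) = {X \<in> RU A ` Pow (suitB A). ccyl RlC 2 X = X}"
      by (simp add: Ra_def ccar_Rl)
    also have "\<dots> = {RU A S | S. S \<subseteq> suitB A \<and> RU A (suitT A 2 `` S) = RU A S}"
      using ccyl_RU by auto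
    also have "\<dots> = {RU A S | S. S \<subseteq> suitB A \<and> suitT A 2 `` S = S}"
      by (simp add: RU_eq_iff suitT_subset cong: conj_cong)
    finally show ?thesis .
  qed
  have bij: "bij_betw ?f \<K> (wcar (Ra RlC))"
    unfolding bij_betw_def
  proof
    show "inj_on ?f \<K>"
      using RU_eq_iff[OF edge_below_subset edge_below_subset] edge_below_inj by (auto simp: inj_on_def)
    show "?f ` \<K> = wcar (Ra RlC)"
    proof (intro equalityI subsetI)
      fix X assume "X \<in> ?f ` \<K>"
      then show "X \<in> wcar (Ra RlC)"
        unfolding car using suitT_edge_below edge_below_subset by blast
    next
      fix X assume "X \<in> wcar (Ra RlC)"
      then obtain S where S: "S \<subseteq> suitB A" "suitT A 2 `` S = S" "X = RU A S"
        unfolding car by blast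
      then show "X \<in> ?f ` \<K>" using ex_edge_below[OF assms S(1,2)] by blast
    qed
  qed
  have f_id: "?f \<e> = wid (Ra RlC)"
    by (simp add: Ra_def cdiag_RU edge_below_id)
  have f_compl: "?f (\<ominus> x) = wcompl (Ra RlC) (?f x)" if "x \<in> \<K>" for x
    using that by (simp add: Ra_def ccompl_RU edge_below_compl edge_below_subset)
  \<comment> \<open>Three substitutions rotate the condition from edge 2 to edge 1, to edge 0 and
    back to edge 2; only the last reverses the direction.\<close>
  have f_cnv: "?f (x\<acute>) = wconv (Ra RlC) (?f x)" if "x \<in> \<K>" for x
    using that cyl_12[of x] cyl_01[of x] by (simp add: Ra_def RU cyl_20)
  have f_add: "?f (x \<oplus> y) = wplus (Ra RlC) (?f x) (?f y)" if "x \<in> \<K>" "y \<in> \<K>" for x y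
    using that by (simp add: Ra_def Rl_simps edge_below_add RU_union)
  have f_mul: "?f (x \<odot> y) = wcomp (Ra RlC) (?f x) (?f y)" if "x \<in> \<K>" "y \<in> \<K>" for x y
    using that cyl_12[of x] cyl_mul[OF that] by (simp add: Ra_def RU cyl_02)
  show ?thesis
    unfolding wa_iso_def by (intro exI[of _ ?f] conjI ballI bij f_id f_compl f_cnv f_add f_mul)
qed

end

theorem theorem6:
  fixes A :: "'a wa_alg"
  assumes "is_wa A" and "wa_complete A" and "wa_atomic A"
  shows "wa_iso A (Ra (Rl (UB A) (VB A) (cgen (UB A) (RB A ` suitB A))))
       \<and> set_atoms (ccar (Rl (UB A) (VB A) (cgen (UB A) (RB A ` suitB A)))) = RB A ` suitB A"
proof -
  interpret atomic_weakly_associative A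
    using assms by unfold_locales
  show ?thesis
    using wa_iso_Ra[OF assms(2)] set_atoms_RU by (simp add: ccar_Rl)
qed

end
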